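(* For every $\alpha>1$, $\dim_{\mathcal{H}}(\Theta_\alpha)=\dim_{\mathcal{H}}(\underline{\Theta}_\alpha)=2/(\alpha+1)$ and $\Lambda(\overline{\Theta}_\alpha)=1$, where $\dim_{\mathcal{H}}$ denotes the Hausdorff dimension and $\Lambda$ denotes the one-dimensional Lebesgue measure.
   Context: For irrational $\theta\in[0,1]$ write its continued fraction expansion as $\theta=[0;a_1,a_2,\dots]$ with $a_n\in\mathbb{N}=\{1,2,\dots\}$, and set $q_0=1$, $q_1=a_1$, $q_n=a_nq_{n-1}+q_{n-2}$ for $n\ge2$. For $\alpha\ge1$ let $A_\alpha(\theta)=\limsup_{n\to\infty}a_nq_{n-1}^{1-\alpha}\in[0,\infty]$. Define (as sets of irrational numbers in $[0,1]$) $\underline{\Theta}_\alpha=\{\theta\in[0,1]:A_\alpha(\theta)>0\}$, $\overline{\Theta}_\alpha=\{\theta\in[0,1]:A_\alpha(\theta)<\infty\}$ and $\Theta_\alpha=\underline{\Theta}_\alpha\cap\overline{\Theta}_\alpha$. *)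

theory Defs
  imports "HOL-Analysis.Analysis"
begin

section \<open>Hausdorff measure and Hausdorff dimension\<close>

text \<open>
  The case distinctions fix the usual conventions for the weight \<open>diam(U)\<^sup>s\<close>: the empty set
  has weight \<open>0\<close>, and \<open>0\<^sup>0 = 1\<close> for singletons (whereas \<open>0 powr 0 = 0\<close>), so that the
  \<open>0\<close>-dimensional Hausdorff measure counts points.
\<close>

definition diam_weight :: "real \<Rightarrow> 'a::metric_space set \<Rightarrow> ennreal" where
  "diam_weight s U =
     (if U = {} then 0 else if s = 0 then 1 else ennreal (diameter U powr s))"

text \<open>
  Boundedness of the covering sets is required explicitly, because \<open>diameter\<close> is real-valued and
  carries no information for unbounded sets. Finite covers are included, since the sets may be empty.
\<close>

definition delta_covers :: "real \<Rightarrow> 'a::metric_space set \<Rightarrow> (nat \<Rightarrow> 'a set) set" where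
  "delta_covers \<delta> S =
     {U. S \<subseteq> (\<Union>i. U i) \<and> (\<forall>i. bounded (U i) \<and> diameter (U i) \<le> \<delta>)}"

definition hausdorff_premeasure :: "real \<Rightarrow> real \<Rightarrow> 'a::metric_space set \<Rightarrow> ennreal" where
  "hausdorff_premeasure s \<delta> S = (INF U \<in> delta_covers \<delta> S. \<Sum>i. diam_weight s (U i))"

definition hausdorff_measure :: "real \<Rightarrow> 'a::metric_space set \<Rightarrow> ennreal" where
  "hausdorff_measure s S = (SUP \<delta> \<in> {0<..}. hausdorff_premeasure s \<delta> S)"

definition hausdorff_dim :: "'a::metric_space set \<Rightarrow> ennreal" where
  "hausdorff_dim S = Inf {ennreal s | s. 0 \<le> s \<and> hausdorff_measure s S = 0}"


section \<open>Continued fractions\<close>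

text \<open>
  \<open>cf_quot \<theta> n\<close> is the \<open>n\<close>-th complete quotient \<open>[a\<^sub>n; a\<^sub>n\<^sub>+\<^sub>1, \<dots>]\<close> and
  \<open>cf_digit \<theta> n\<close> the partial quotient \<open>a\<^sub>n\<close> of \<open>\<theta> = [a\<^sub>0; a\<^sub>1, a\<^sub>2, \<dots>]\<close>; they are
  only meaningful for all \<open>n\<close> if \<open>\<theta>\<close> is irrational, and \<open>a\<^sub>0 = 0\<close> if
  moreover \<open>\<theta> \<in> [0,1]\<close>.
\<close>

primrec cf_quot :: "real \<Rightarrow> nat \<Rightarrow> real" where
  "cf_quot \<theta> 0 = \<theta>"
| "cf_quot \<theta> (Suc n) = 1 / frac (cf_quot \<theta> n)"

definition cf_digit :: "real \<Rightarrow> nat \<Rightarrow> int" where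
  "cf_digit \<theta> n = \<lfloor>cf_quot \<theta> n\<rfloor>"

fun cf_denom :: "real \<Rightarrow> nat \<Rightarrow> int" where
  "cf_denom \<theta> 0 = 1"
| "cf_denom \<theta> (Suc 0) = cf_digit \<theta> 1"
| "cf_denom \<theta> (Suc (Suc n)) =
     cf_digit \<theta> (Suc (Suc n)) * cf_denom \<theta> (Suc n) + cf_denom \<theta> n"


section \<open>The sets \<open>\<Theta>\<^sub>\<alpha>\<close>\<close>

text \<open>The sequence \<open>a\<^sub>n q\<^sub>n\<^sub>-\<^sub>1\<^bsup>1-\<alpha>\<^esup>\<close>, \<open>n \<ge> 1\<close>, is indexed from \<open>0\<close> here.\<close>

definition A_exp :: "real \<Rightarrow> real \<Rightarrow> ereal" where
  "A_exp \<alpha> \<theta> =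
     limsup (\<lambda>n. ereal (real_of_int (cf_digit \<theta> (Suc n))
                         * real_of_int (cf_denom \<theta> n) powr (1 - \<alpha>)))"

definition Theta_lower :: "real \<Rightarrow> real set" where
  "Theta_lower \<alpha> = {\<theta> \<in> {0..1}. \<theta> \<notin> \<rat> \<and> A_exp \<alpha> \<theta> > 0}"

definition Theta_upper :: "real \<Rightarrow> real set" where
  "Theta_upper \<alpha> = {\<theta> \<in> {0..1}. \<theta> \<notin> \<rat> \<and> A_exp \<alpha> \<theta> < \<infinity>}"

definition Theta :: "real \<Rightarrow> real set" where
  "Theta \<alpha> = Theta_lower \<alpha> \<inter> Theta_upper \<alpha>"


section \<open>The digits do expand the number\<close>

fun cf_numer :: "real \<Rightarrow> nat \<Rightarrow> int" where
  "cf_numer \<theta> 0 = cf_digit \<theta> 0"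
| "cf_numer \<theta> (Suc 0) = cf_digit \<theta> 1 * cf_digit \<theta> 0 + 1"
| "cf_numer \<theta> (Suc (Suc n)) =
     cf_digit \<theta> (Suc (Suc n)) * cf_numer \<theta> (Suc n) + cf_numer \<theta> n"

lemma cf_quot_irrational:
  assumes "\<theta> \<notin> \<rat>"
  shows "cf_quot \<theta> n \<notin> \<rat>"
proof (induction n)
  case (Suc n)
  show ?case
  proof
    assume "cf_quot \<theta> (Suc n) \<in> \<rat>"
    then have "inverse (cf_quot \<theta> (Suc n)) \<in> \<rat>" by (rule Rats_inverse)
    then have "frac (cf_quot \<theta> n) \<in> \<rat>" by simp
    then have "frac (cf_quot \<theta> n) + of_int \<lfloor>cf_quot \<theta> n\<rfloor> \<in> \<rat>"
      by (intro Rats_add Rats_of_int)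
    with Suc show False by (simp add: frac_def)
  qed
qed (use assms in simp)

lemma cf_quot_step:
  assumes "\<theta> \<notin> \<rat>"
  shows "cf_quot \<theta> (Suc n) > 1"
    and "cf_quot \<theta> n = of_int (cf_digit \<theta> n) + 1 / cf_quot \<theta> (Suc n)"
proof -
  have "frac (cf_quot \<theta> n) \<noteq> 0"
    using cf_quot_irrational[OF assms, of n] by (metis Ints_subset_Rats frac_eq_0_iff subsetD)
  then have "frac (cf_quot \<theta> n) > 0"
    using frac_ge_0[of "cf_quot \<theta> n"] by linarith
  moreover have "frac (cf_quot \<theta> n) < 1" by (rule frac_lt_1)
  ultimately show "cf_quot \<theta> (Suc n) > 1" by simp
  show "cf_quot \<theta> n = of_int (cf_digit \<theta> n) + 1 / cf_quot \<theta> (Suc n)"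
    by (simp add: cf_digit_def frac_def)
qed

lemma cf_digit_ge_1:
  assumes "\<theta> \<notin> \<rat>"
  shows "cf_digit \<theta> (Suc n) \<ge> 1"
  using cf_quot_step(1)[OF assms, of n] unfolding cf_digit_def by linarith

lemma cf_digit_0:
  assumes "\<theta> \<notin> \<rat>" "\<theta> \<in> {0..1}"
  shows "cf_digit \<theta> 0 = 0"
proof -
  have "\<theta> \<noteq> 1" using assms(1) by auto
  then show ?thesis using assms(2) by (auto simp: cf_digit_def floor_eq_iff)
qed

lemma cf_denom_ge:
  assumes "\<theta> \<notin> \<rat>"
  shows "cf_denom \<theta> n \<ge> 1 \<and> cf_denom \<theta> (Suc n) \<ge> int (Suc n)"
proof (induction n)
  case 0
  show ?case using cf_digit_ge_1[OF assms, of 0] by simp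
next
  case (Suc n)
  have "1 * cf_denom \<theta> (Suc n) \<le> cf_digit \<theta> (Suc (Suc n)) * cf_denom \<theta> (Suc n)"
    using cf_digit_ge_1[OF assms, of "Suc n"] Suc by (intro mult_right_mono) auto
  moreover have "cf_denom \<theta> (Suc (Suc n))
      = cf_digit \<theta> (Suc (Suc n)) * cf_denom \<theta> (Suc n) + cf_denom \<theta> n" by simp
  ultimately show ?case using Suc by linarith
qed

lemma cf_quot_identity:
  assumes "\<theta> \<notin> \<rat>"
  shows "\<theta> * (cf_quot \<theta> (Suc (Suc n)) * cf_denom \<theta> (Suc n) + cf_denom \<theta> n)
           = cf_quot \<theta> (Suc (Suc n)) * cf_numer \<theta> (Suc n) + cf_numer \<theta> n"
proof (induction n)
  case 0
  define c d where "c = cf_quot \<theta> (Suc 0)" and "d = cf_quot \<theta> (Suc (Suc 0))"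
  have cd: "c > 1" "d > 1" "c = cf_digit \<theta> (Suc 0) + 1 / d" "\<theta> = cf_digit \<theta> 0 + 1 / c"
    using cf_quot_step[OF assms, of 0] cf_quot_step[OF assms, of "Suc 0"]
    unfolding c_def d_def by (simp_all del: cf_quot.simps(2))
  have "d * cf_digit \<theta> (Suc 0) + 1 = d * c"
    using cd by (simp add: field_simps)
  moreover have "\<theta> * c = cf_digit \<theta> 0 * c + 1"
    using cd(1) by (subst cd(4)) (simp add: field_simps)
  ultimately have "\<theta> * (d * cf_digit \<theta> (Suc 0) + 1)
      = d * (cf_digit \<theta> (Suc 0) * cf_digit \<theta> 0 + 1) + cf_digit \<theta> 0"
    unfolding of_int_add of_int_mult of_int_1 by algebra
  then show ?case by (simp add: d_def del: cf_quot.simps(2))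
next
  case (Suc n)
  define c d where "c = cf_quot \<theta> (Suc (Suc n))" and "d = cf_quot \<theta> (Suc (Suc (Suc n)))"
  have cd: "d > 1" "c = cf_digit \<theta> (Suc (Suc n)) + 1 / d"
    using cf_quot_step[OF assms, of "Suc (Suc n)"] unfolding c_def d_def
    by (simp_all del: cf_quot.simps(2))
  then have "d * cf_digit \<theta> (Suc (Suc n)) + 1 = d * c"
    by (simp add: field_simps)
  with Suc[folded c_def] have
    "\<theta> * (d * (cf_digit \<theta> (Suc (Suc n)) * cf_denom \<theta> (Suc n) + cf_denom \<theta> n) + cf_denom \<theta> (Suc n))
     = d * (cf_digit \<theta> (Suc (Suc n)) * cf_numer \<theta> (Suc n) + cf_numer \<theta> n) + cf_numer \<theta> (Suc n)"
    unfolding of_int_add of_int_mult of_int_1 by algebra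
  then show ?case by (simp add: d_def del: cf_quot.simps(2))
qed

lemma cf_determinant:
  "\<bar>cf_numer \<theta> (Suc n) * cf_denom \<theta> n - cf_numer \<theta> n * cf_denom \<theta> (Suc n)\<bar> = 1"
proof (induction n)
  case (Suc n)
  have "cf_numer \<theta> (Suc (Suc n)) * cf_denom \<theta> (Suc n) - cf_numer \<theta> (Suc n) * cf_denom \<theta> (Suc (Suc n))
      = - (cf_numer \<theta> (Suc n) * cf_denom \<theta> n - cf_numer \<theta> n * cf_denom \<theta> (Suc n))"
    by (simp add: algebra_simps)
  with Suc show ?case by (simp only: abs_minus_cancel)
qed simp

theorem cf_convergents_tendsto:
  assumes "\<theta> \<notin> \<rat>"
  shows "(\<lambda>n. real_of_int (cf_numer \<theta> n) / real_of_int (cf_denom \<theta> n)) \<longlonglongrightarrow> \<theta>"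
proof -
  have bound: "\<bar>cf_numer \<theta> (Suc n) / cf_denom \<theta> (Suc n) - \<theta>\<bar> \<le> 1 / real (Suc n)" for n
  proof -
    define c where "c = cf_quot \<theta> (Suc (Suc n))"
    define p q p' q' :: real where "p = cf_numer \<theta> n" and "q = cf_denom \<theta> n"
      and "p' = cf_numer \<theta> (Suc n)" and "q' = cf_denom \<theta> (Suc n)"
    have q: "q \<ge> 1" "q' \<ge> real (Suc n)"
      using cf_denom_ge[OF assms, of n] unfolding q_def q'_def by linarith+
    have c: "c > 1" using cf_quot_step(1)[OF assms, of "Suc n"] by (simp only: c_def)
    have id: "\<theta> * (c * q' + q) = c * p' + p"
      using cf_quot_identity[OF assms, of n] unfolding c_def p_def q_def p'_def q'_def by simp
    have "real_of_int \<bar>cf_numer \<theta> (Suc n) * cf_denom \<theta> n - cf_numer \<theta> n * cf_denom \<theta> (Suc n)\<bar> = 1"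
      by (simp only: cf_determinant of_int_1)
    then have det: "\<bar>p' * q - p * q'\<bar> = 1"
      unfolding p_def q_def p'_def q'_def by simp
    have pos: "c * q' + q \<ge> 1" "q' \<ge> 1" using c q by (auto intro: add_nonneg_nonneg add_increasing)
    have "(p' - \<theta> * q') * (c * q' + q) = p' * q - p * q'"
      using id by algebra
    then have "\<bar>p' - \<theta> * q'\<bar> * (c * q' + q) = 1"
      using det pos by (metis abs_mult abs_of_nonneg dual_order.trans zero_le_one)
    then have "\<bar>p' - \<theta> * q'\<bar> \<le> 1"
      using pos by (metis abs_ge_zero mult.right_neutral mult_left_mono)
    moreover have "p' / q' - \<theta> = (p' - \<theta> * q') / q'" using pos by (simp add: field_simps)
    ultimately have "\<bar>p' / q' - \<theta>\<bar> \<le> 1 / q'"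
      using pos by (simp add: divide_right_mono)
    also have "\<dots> \<le> 1 / real (Suc n)" using q by (intro divide_left_mono) auto
    finally show ?thesis by (simp only: p'_def q'_def)
  qed
  have "(\<lambda>n. cf_numer \<theta> (Suc n) / cf_denom \<theta> (Suc n) - \<theta>) \<longlonglongrightarrow> 0"
    by (rule Lim_null_comparison[OF _ LIMSEQ_Suc[OF lim_1_over_n]]) (use bound in auto)
  then have "(\<lambda>n. cf_numer \<theta> (Suc n) / cf_denom \<theta> (Suc n)) \<longlonglongrightarrow> \<theta>"
    by (simp add: LIM_zero_iff)
  then show ?thesis by (rule LIMSEQ_imp_Suc)
qed

end

theory Submission
  imports Defs
begin

text \<open>
  Put \<open>\<tau> = \<alpha> + 1\<close>. Since \<open>|\<theta> - p\<^sub>n/q\<^sub>n|\<close> is comparable to \<open>1/(a\<^sub>n\<^sub>+\<^sub>1q\<^sub>n\<^sup>2)\<close>, positivity of \<open>A\<^sub>\<alpha>(\<theta>)\<close> means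
  that \<open>|\<theta> - p/q| \<le> C q\<^sup>-\<^sup>\<tau>\<close> infinitely often, and finiteness that \<open>|\<theta> - p/q| \<ge> c q\<^sup>-\<^sup>\<tau>\<close> always.
  The upper bound for the dimension comes from covering by intervals of radius slightly above \<open>q\<^sup>-\<^sup>\<tau>\<close>
  about all fractions \<open>p/q\<close>; as \<open>2/\<tau> < 1\<close>, the same covers show that \<open>A\<^sub>\<alpha> = \<infinity>\<close> has measure zero.

  For the lower bound, let \<open>J\<close> be an interval of length \<open>l\<close> that stays \<open>c q\<^sup>-\<^sup>\<tau>\<close> away from all fractions with
  denominator \<open>q < H\<close>. Points of \<open>J\<close> that come within \<open>3c q\<^sup>-\<^sup>\<tau>\<close> of a fraction with \<open>q \<ge> H\<close> have small measure,
  so by Dirichlet's theorem \<open>J\<close> contains, for every large \<open>M\<close>, at least a constant times \<open>l M\<^sup>2\<close> fractions \<open>P/Q\<close> with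
  \<open>M/64 \<le> Q \<le> M\<close> near such good points. Next to each of them sits the child interval
  \<open>[P/Q + M\<^sup>-\<^sup>\<tau>, P/Q + 2M\<^sup>-\<^sup>\<tau>]\<close>, which avoids the fractions with denominators up to \<open>M\<^sup>\<alpha>/4\<close> with the same
  constant \<open>c\<close>. If \<open>s < 2/\<tau>\<close> and a cover has small total weight \<open>\<Sum> diam(U\<^sub>i)\<^sup>s\<close>, the pigeonhole principle gives a child
  \<open>J'\<close> such that the sets meeting \<open>J'\<close> have total weight at most \<open>\<rho> |J'|\<^sup>s\<close>. Iterating, the nested
  intervals shrink to a point of \<open>\<Theta>\<^sub>\<alpha>\<close> outside every \<open>U\<^sub>i\<close>.
\<close>

section \<open>Fractions near an interval\<close>

text \<open>Cut the line into half-open cells of length \<delta> starting at \<open>a\<close>. Two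
  points in one cell would be closer than \<delta>, so the cell number \<open>f\<close> is injective
  on \<open>S\<close>.\<close>

lemma separated_card:
  fixes S :: "real set"
  assumes S: "S \<subseteq> {a..b}" and "\<delta> > 0" "a \<le> b"
    and sep: "\<And>x y. x \<in> S \<Longrightarrow> y \<in> S \<Longrightarrow> x \<noteq> y \<Longrightarrow> \<delta> \<le> \<bar>x - y\<bar>"
  shows "finite S" "real (card S) \<le> 1 + (b - a) / \<delta>"
proof -
  define f where "f x = nat \<lfloor>(x - a) / \<delta>\<rfloor>" for x
  have inj: "inj_on f S"
  proof (rule inj_onI, rule ccontr)
    fix x y assume xy: "x \<in> S" "y \<in> S" "f x = f y" "x \<noteq> y"
    have nn: "0 \<le> (x - a) / \<delta>" "0 \<le> (y - a) / \<delta>" using xy S \<open>\<delta> > 0\<close> by auto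
    then have "\<lfloor>(x - a) / \<delta>\<rfloor> = \<lfloor>(y - a) / \<delta>\<rfloor>" using xy(3) unfolding f_def by (simp add: eq_nat_nat_iff)
    then have "\<bar>(x - a) / \<delta> - (y - a) / \<delta>\<bar> < 1" by linarith
    then have "\<bar>(x - y) / \<delta>\<bar> < 1" by (simp add: diff_divide_distrib)
    then have "\<bar>x - y\<bar> < \<delta>" using \<open>\<delta> > 0\<close> by (simp add: abs_divide)
    with sep[OF xy(1,2,4)] show False by linarith
  qed
  have im: "f ` S \<subseteq> {..nat \<lfloor>(b - a) / \<delta>\<rfloor>}"
    using S \<open>\<delta> > 0\<close> unfolding f_def by (auto intro!: nat_mono floor_mono divide_right_mono)
  show fin: "finite S" using inj_on_finite[OF inj im] by simp
  have "card S \<le> Suc (nat \<lfloor>(b - a) / \<delta>\<rfloor>)"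
    using card_inj_on_le[OF inj im] by simp
  moreover have "0 \<le> (b - a) / \<delta>" using assms by simp
  ultimately have "real (card S) \<le> 1 + real (nat \<lfloor>(b - a) / \<delta>\<rfloor>)" by linarith
  then show "real (card S) \<le> 1 + (b - a) / \<delta>" using \<open>0 \<le> (b - a) / \<delta>\<close> by linarith
qed

lemma distinct_fractions_dist:
  fixes p p' :: int and q q' :: nat
  assumes "q \<ge> 1" "q' \<ge> 1" "real_of_int p / real q \<noteq> real_of_int p' / real q'"
  shows "1 / (real q * real q') \<le> \<bar>real_of_int p / real q - real_of_int p' / real q'\<bar>"
proof -
  have eq: "real_of_int p / real q - real_of_int p' / real q'
      = real_of_int (p * int q' - p' * int q) / (real q * real q')"
    using assms by (simp add: field_simps)
  then have "p * int q' - p' * int q \<noteq> 0"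
    using assms(3) by (metis diff_eq_diff_eq div_0 of_int_0 right_minus_eq)
  then have "1 \<le> \<bar>p * int q' - p' * int q\<bar>" by linarith
  then have "1 \<le> \<bar>real_of_int (p * int q' - p' * int q)\<bar>"
    by (metis of_int_1_le_iff of_int_abs)
  then show ?thesis unfolding eq abs_divide
    using assms by (simp add: abs_mult divide_right_mono)
qed

definition fractions_upto :: "real \<Rightarrow> real set" where
  "fractions_upto D = {real_of_int p / real q | p q. 1 \<le> q \<and> real q \<le> D}"

lemma fractions_upto_separated:
  assumes "x \<in> fractions_upto D" "y \<in> fractions_upto D" "x \<noteq> y"
  shows "1 / D\<^sup>2 \<le> \<bar>x - y\<bar>"
proof -
  obtain p q p' q' where *: "x = real_of_int p / real q" "y = real_of_int p' / real q'"
     "1 \<le> q" "real q \<le> D" "1 \<le> q'" "real q' \<le> D"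
    using assms unfolding fractions_upto_def by blast
  have "real q * real q' \<le> D\<^sup>2" unfolding power2_eq_square using * by (intro mult_mono) auto
  then have "1 / D\<^sup>2 \<le> 1 / (real q * real q')" using * by (intro divide_left_mono) auto
  also have "\<dots> \<le> \<bar>x - y\<bar>" using distinct_fractions_dist[of q q' p p'] * assms(3) by simp
  finally show ?thesis .
qed

lemma fractions_upto_card:
  assumes "D \<ge> 1" "a \<le> b"
  shows "finite (fractions_upto D \<inter> {a..b})"
    "real (card (fractions_upto D \<inter> {a..b})) \<le> 1 + (b - a) * D\<^sup>2"
  using separated_card[of "fractions_upto D \<inter> {a..b}" a b "1 / D\<^sup>2"]
    fractions_upto_separated[of _ D] assms by auto

lemma emeasure_neighbourhood:
  fixes F :: "real set"
  assumes "finite F" "e \<ge> 0"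
  shows "emeasure lborel (\<Union>r\<in>F. {r - e..r + e}) \<le> ennreal (real (card F) * (2 * e))"
proof -
  have "emeasure lborel (\<Union>r\<in>F. {r - e..r + e}) \<le> (\<Sum>r\<in>F. emeasure lborel {r - e..r + e})"
    by (rule emeasure_subadditive_finite) (use assms in auto)
  also have "\<dots> = (\<Sum>r\<in>F. ennreal (2 * e))" using assms by (intro sum.cong) auto
  also have "\<dots> = ennreal (real (card F) * (2 * e))"
    using assms by (simp add: ennreal_mult ennreal_of_nat_eq_real_of_nat)
  finally show ?thesis .
qed

lemma dyadic_block:
  fixes H x :: real
  assumes "0 < H" "H \<le> x"
  obtains k :: nat where "2 ^ k * H \<le> x" "x \<le> 2 * (2 ^ k * H)"
proof -
  obtain n where n: "x / H < 2 ^ n" using real_arch_pow[of 2 "x / H"] by auto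
  define m where "m = (LEAST n. x / H < 2 ^ n)"
  have m: "x / H < 2 ^ m" unfolding m_def using n by (rule LeastI)
  have "m \<noteq> 0" using m assms by (cases m) (auto simp: field_simps)
  then obtain k where k: "m = Suc k" using not0_implies_Suc by blast
  have "\<not> x / H < 2 ^ k" unfolding m_def[symmetric]
    using not_less_Least[of k "\<lambda>n. x / H < 2 ^ n"] k m_def by auto
  then show ?thesis using that[of k] m k assms by (simp add: field_simps)
qed

text \<open>Split the denominators into dyadic blocks \<open>[D k, 2 * D k]\<close> and multiply the
  number of fractions in a block by the length of their neighbourhoods. The k-th block costs at most
  \<open>54 * c * l * \<beta> ^ k\<close> with \<beta> < 1, and the geometric series stays below
  \<open>l / 8\<close> because 432 = 8 * 54.\<close>

lemma bad_set_small:
  assumes \<tau>: "\<tau> > 2" and c: "0 < c" "432 * c \<le> 1 - 2 powr (2 - \<tau>)"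
    and l: "0 < l" and H: "1 \<le> H" "H powr - \<tau> \<le> l"
  obtains B where "B \<in> sets lborel" "emeasure lborel B \<le> ennreal (l / 8)"
    "\<And>x p q. x \<in> {u..u + l} \<Longrightarrow> H \<le> real q \<Longrightarrow>
       \<bar>x - real_of_int p / real q\<bar> < 3 * c * real q powr - \<tau> \<Longrightarrow> x \<in> B"
proof -
  define \<beta> :: real where "\<beta> = 2 powr (2 - \<tau>)"
  have \<beta>: "0 < \<beta>" "\<beta> < 1" using \<tau> unfolding \<beta>_def by (auto simp: powr_less_one)
  have c6: "6 * c \<le> 1" using c \<beta> unfolding \<beta>_def[symmetric] by linarith
  define D where "D k = 2 ^ k * H" for k :: nat
  define e where "e k = 3 * c * D k powr - \<tau>" for k
  define F where "F k = fractions_upto (2 * D k) \<inter> {u - e k..u + l + e k}" for k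
  define B where "B k = (\<Union>r\<in>F k. {r - e k..r + e k})" for k
  have D1: "1 \<le> D k" for k
    using mult_mono[of 1 "2 ^ k" 1 H] H unfolding D_def by simp
  have e0: "0 < e k" for k using c D1[of k] unfolding e_def by auto
  \<comment> \<open>\<open>Dt\<close> pays for the summand 1 in the count \<open>cardF\<close>, a
    fraction that may occur however short the interval is; here
    \<open>H powr - \<tau> \<le> l\<close> enters. \<open>D2t\<close> pays for the summand
    proportional to the length.\<close>
  have Dt: "D k powr - \<tau> \<le> l * \<beta> ^ k" for k
  proof -
    have "D k powr - \<tau> = (2 ^ k) powr - \<tau> * H powr - \<tau>"
      unfolding D_def using H by (simp add: powr_mult)
    also have "(2 ^ k :: real) powr - \<tau> = 2 powr (- \<tau> * real k)"
      by (simp add: powr_realpow[symmetric] powr_powr mult.commute)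
    also have "\<dots> \<le> 2 powr ((2 - \<tau>) * real k)"
      by (intro powr_mono mult_right_mono) auto
    also have "\<dots> = \<beta> ^ k" using \<beta> by (simp add: \<beta>_def powr_realpow[symmetric] powr_powr)
    finally have "D k powr - \<tau> \<le> \<beta> ^ k * H powr - \<tau>" by (simp add: mult_right_mono)
    also have "\<dots> \<le> \<beta> ^ k * l" using H \<beta> by (intro mult_left_mono) auto
    finally show ?thesis by (simp add: mult.commute)
  qed
  have D2t: "(D k)\<^sup>2 * D k powr - \<tau> \<le> \<beta> ^ k" for k
  proof -
    have "(D k)\<^sup>2 * D k powr - \<tau> = D k powr (2 - \<tau>)"
      using D1[of k] by (simp add: powr_diff powr_minus divide_inverse)
    also have "\<dots> = (2 ^ k) powr (2 - \<tau>) * H powr (2 - \<tau>)"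
      unfolding D_def using H by (simp add: powr_mult)
    also have "H powr (2 - \<tau>) \<le> 1" using H \<tau> using powr_mono[of "2 - \<tau>" 0 H] by simp
    also have "(2 ^ k :: real) powr (2 - \<tau>) = \<beta> ^ k"
      using \<beta> by (simp add: \<beta>_def powr_realpow[symmetric] powr_powr mult.commute)
    finally show ?thesis using \<beta> by (simp add: mult_left_mono)
  qed
  have finF: "finite (F k)" and cardF: "real (card (F k)) \<le> 1 + (l + 2 * e k) * (2 * D k)\<^sup>2" for k
    using fractions_upto_card[of "2 * D k" "u - e k" "u + l + e k"] D1[of k] l e0[of k]
    unfolding F_def by (auto simp: algebra_simps)
  have meas: "emeasure lborel (B k) \<le> ennreal (54 * c * l * \<beta> ^ k)" for k
  proof -
    have "D k powr - \<tau> \<le> l"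
      using Dt[of k] l \<beta> power_le_one[of \<beta> k] mult_left_le[of "\<beta> ^ k" l] by linarith
    then have "2 * e k \<le> 6 * c * l" unfolding e_def using c by simp
    also have "\<dots> \<le> 1 * l" using c6 l by (intro mult_right_mono) auto
    finally have "2 * e k \<le> l" by simp
    then have "(l + 2 * e k) * (2 * D k)\<^sup>2 \<le> (2 * l) * (2 * D k)\<^sup>2" by (intro mult_right_mono) auto
    then have "real (card (F k)) \<le> 1 + 8 * l * (D k)\<^sup>2" using cardF[of k] by (simp add: power2_eq_square) argo
    then have "real (card (F k)) * (2 * e k) \<le> (1 + 8 * l * (D k)\<^sup>2) * (2 * e k)"
      using e0[of k] by (intro mult_right_mono) auto
    also have "\<dots> = 6 * c * (D k powr - \<tau>) + 48 * c * l * ((D k)\<^sup>2 * D k powr - \<tau>)"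
      unfolding e_def by (simp add: algebra_simps)
    also have "\<dots> \<le> 6 * c * (l * \<beta> ^ k) + 48 * c * l * \<beta> ^ k"
      using c l Dt[of k] D2t[of k] by (intro add_mono mult_left_mono) auto
    finally have "real (card (F k)) * (2 * e k) \<le> 54 * c * l * \<beta> ^ k" by simp
    then show ?thesis unfolding B_def
      using emeasure_neighbourhood[OF finF[of k], of "e k"] e0[of k] by (meson ennreal_leI less_imp_le order_trans)
  qed
  have Bs: "B k \<in> sets lborel" for k unfolding B_def using finF[of k] by auto
  have "emeasure lborel (\<Union>k. B k) \<le> (\<Sum>k. emeasure lborel (B k))"
    by (rule emeasure_subadditive_countably) (use Bs in auto)
  also have "\<dots> \<le> (\<Sum>k. ennreal (54 * c * l * \<beta> ^ k))"
    using meas by (intro suminf_le) auto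
  also have "\<dots> = ennreal (\<Sum>k. 54 * c * l * \<beta> ^ k)"
    using c l \<beta> by (intro suminf_ennreal2) (auto intro!: summable_mult summable_geometric)
  also have "(\<Sum>k. 54 * c * l * \<beta> ^ k) = 54 * c * l * (1 / (1 - \<beta>))"
    using \<beta> by (subst suminf_mult) (auto simp: suminf_geometric summable_geometric)
  also have "\<dots> \<le> l / 8"
    using mult_right_mono[of "432 * c" "1 - \<beta>" l] c l \<beta> unfolding \<beta>_def[symmetric] by (simp add: field_simps)
  finally have "emeasure lborel (\<Union>k. B k) \<le> ennreal (l / 8)" by (simp add: ennreal_leI)
  moreover have "x \<in> (\<Union>k. B k)"
    if x: "x \<in> {u..u + l}" and q: "H \<le> real q" and near: "\<bar>x - real_of_int p / real q\<bar> < 3 * c * real q powr - \<tau>"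
    for x p q
  proof -
    obtain k where k: "D k \<le> real q" "real q \<le> 2 * D k"
      using dyadic_block[of H "real q"] H q unfolding D_def by auto
    have "real q powr - \<tau> \<le> D k powr - \<tau>" using k D1[of k] \<tau> by (intro powr_mono2') auto
    then have "\<bar>x - real_of_int p / real q\<bar> \<le> e k"
      using near c mult_left_mono[of "real q powr - \<tau>" "D k powr - \<tau>" "3 * c"] unfolding e_def by linarith
    moreover have "1 \<le> q" using q H by linarith
    then have "real_of_int p / real q \<in> fractions_upto (2 * D k)"
      unfolding fractions_upto_def using k by blast
    ultimately have "real_of_int p / real q \<in> F k" "x \<in> {real_of_int p / real q - e k..real_of_int p / real q + e k}"
      unfolding F_def using x by auto
    then show ?thesis unfolding B_def by blast
  qed
  ultimately show thesis using that[of "\<Union>k. B k"] Bs by blast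
qed

text \<open>The strict bound on \<open>real q\<close> makes the condition vacuous for
  \<open>H = 1\<close>, so that the construction can start from the unit interval.\<close>

definition avoids :: "real \<Rightarrow> real \<Rightarrow> real \<Rightarrow> real \<Rightarrow> real \<Rightarrow> bool" where
  "avoids c \<tau> u l H \<longleftrightarrow>
     (\<forall>y\<in>{u..u + l}. \<forall>q p. 1 \<le> q \<longrightarrow> real q < H \<longrightarrow>
        c * real q powr - \<tau> \<le> \<bar>y - real_of_int p / real q\<bar>)"

lemma avoidsD:
  assumes "avoids c \<tau> u l H" "y \<in> {u..u + l}" "1 \<le> q" "real q < H"
  shows "c * real q powr - \<tau> \<le> \<bar>y - real_of_int p / real q\<bar>"
  using assms unfolding avoids_def by blast

section \<open>Dirichlet fractions with denominators comparable to M\<close>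

lemma dirichlet_nat:
  fixes x :: real and M :: nat
  assumes "M \<ge> 1"
  obtains P :: int and Q :: nat where "coprime P (int Q)" "1 \<le> Q" "Q \<le> M"
    "\<bar>x - real_of_int P / real Q\<bar> < 1 / (real Q * real M)"
proof -
  obtain h k where hk: "coprime h k" "0 < k" "k \<le> int M" "\<bar>of_int k * x - of_int h\<bar> < 1 / real M"
    using Dirichlet_approx_coprime[of M x] assms by auto
  define Q where "Q = nat k"
  have Q: "int Q = k" "real_of_int k = real Q" "1 \<le> Q" "Q \<le> M" using hk unfolding Q_def by auto
  have "x - real_of_int h / real Q = (of_int k * x - of_int h) / real Q"
    using Q by (simp add: field_simps)
  then have "\<bar>x - real_of_int h / real Q\<bar> = \<bar>of_int k * x - of_int h\<bar> / real Q" by (simp add: abs_divide)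
  also have "\<dots> < (1 / real M) / real Q" using hk(4) Q by (intro divide_strict_right_mono) auto
  finally show thesis using that[of h Q] Q hk by (simp add: mult.commute)
qed

text \<open>Each denominator \<open>Q\<close> costs at most
  \<open>4 * Q * l * 2 / (Q * M) = 8 * l / M\<close>, whatever its size, and at most
  \<open>M / 64\<close> of them occur. The bound \<open>1 \<le> real Q * l\<close> absorbs the
  summand 1 of the count.\<close>

lemma small_denominators_small:
  assumes l: "0 < l" and M: "2 \<le> M"
  obtains B where "B \<in> sets lborel" "emeasure lborel B \<le> ennreal (l / 8)"
    "\<And>x P Q. x \<in> {u..u + l} \<Longrightarrow> 1 \<le> real Q * l \<Longrightarrow> 64 * Q \<le> M \<Longrightarrow>
       \<bar>x - real_of_int P / real Q\<bar> \<le> 1 / (real Q * real M) \<Longrightarrow> x \<in> B"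
proof -
  define S where "S = {Q. 1 \<le> Q \<and> 1 \<le> real Q * l \<and> 64 * Q \<le> M}"
  define e where "e Q = 1 / (real Q * real M)" for Q :: nat
  define R where "R Q = range (\<lambda>P::int. real_of_int P / real Q) \<inter> {u - e Q..u + l + e Q}" for Q :: nat
  define B where "B Q = (\<Union>r\<in>R Q. {r - e Q..r + e Q})" for Q
  have S_sub: "S \<subseteq> {1..M div 64}" unfolding S_def by auto
  then have S: "finite S" "card S \<le> M div 64" using finite_subset card_mono[OF _ S_sub] by auto
  have BQ: "B Q \<in> sets lborel" "emeasure lborel (B Q) \<le> ennreal (8 * l / real M)" if "Q \<in> S" for Q
  proof -
    have Q: "1 \<le> Q" "1 \<le> real Q * l" using that unfolding S_def by auto
    have e0: "0 < e Q" using Q M unfolding e_def by simp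
    have sep: "1 / real Q \<le> \<bar>x - y\<bar>" if xy: "x \<in> R Q" "y \<in> R Q" "x \<noteq> y" for x y
    proof -
      obtain p p' :: int where p: "x = real_of_int p / real Q" "y = real_of_int p' / real Q"
        using xy unfolding R_def by auto
      then have "p - p' \<noteq> 0" using xy by auto
      then have "1 \<le> \<bar>real_of_int (p - p')\<bar>" by linarith
      moreover have "x - y = real_of_int (p - p') / real Q" using p by (simp add: diff_divide_distrib)
      ultimately show ?thesis by (simp add: abs_divide divide_right_mono)
    qed
    have fin: "finite (R Q)" and card: "real (card (R Q)) \<le> 1 + (l + 2 * e Q) * real Q"
      using separated_card[of "R Q" "u - e Q" "u + l + e Q" "1 / real Q"] sep e0 l Q
      unfolding R_def by (auto simp: algebra_simps)
    have "e Q * real Q = 1 / real M" using Q unfolding e_def by simp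
    moreover have "1 / real M \<le> 1 / 2" using M by (simp add: field_simps)
    ultimately have "real (card (R Q)) \<le> 4 * (real Q * l)"
      using card Q by (simp add: algebra_simps)
    then have "real (card (R Q)) * (2 * e Q) \<le> 4 * (real Q * l) * (2 * e Q)"
      using e0 by (intro mult_right_mono) auto
    also have "\<dots> = 8 * l / real M" using Q M unfolding e_def by (simp add: field_simps)
    finally show "emeasure lborel (B Q) \<le> ennreal (8 * l / real M)" unfolding B_def
      using emeasure_neighbourhood[OF fin, of "e Q"] e0 by (meson ennreal_leI less_imp_le order_trans)
    show "B Q \<in> sets lborel" unfolding B_def using fin by auto
  qed
  have "emeasure lborel (\<Union>Q\<in>S. B Q) \<le> (\<Sum>Q\<in>S. emeasure lborel (B Q))"
    using S BQ by (intro emeasure_subadditive_finite) auto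
  also have "\<dots> \<le> (\<Sum>Q\<in>S. ennreal (8 * l / real M))" using BQ by (intro sum_mono) auto
  also have "\<dots> = ennreal (real (card S) * (8 * l / real M))"
    using l by (subst ennreal_mult) (auto simp: ennreal_of_nat_eq_real_of_nat)
  also have "\<dots> \<le> ennreal (l / 8)"
  proof (rule ennreal_leI)
    have "64 * card S \<le> M" using S(2) by linarith
    then have "real (card S) \<le> real M / 64" by linarith
    then have "real (card S) * (8 * l / real M) \<le> real M / 64 * (8 * l / real M)"
      using l by (intro mult_right_mono) auto
    then show "real (card S) * (8 * l / real M) \<le> l / 8" using M by simp
  qed
  finally have "emeasure lborel (\<Union>Q\<in>S. B Q) \<le> ennreal (l / 8)" .
  moreover have "(\<Union>Q\<in>S. B Q) \<in> sets lborel" using S BQ by auto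
  moreover have "x \<in> (\<Union>Q\<in>S. B Q)"
    if x: "x \<in> {u..u + l}" and Q: "1 \<le> real Q * l" "64 * Q \<le> M"
      and near: "\<bar>x - real_of_int P / real Q\<bar> \<le> 1 / (real Q * real M)" for x P Q
  proof -
    have "1 \<le> Q" using Q by (cases Q) auto
    then have "Q \<in> S" using Q unfolding S_def by auto
    moreover have "real_of_int P / real Q \<in> R Q" using x near unfolding R_def e_def by auto
    moreover have "x \<in> {real_of_int P / real Q - e Q..real_of_int P / real Q + e Q}"
      using near unfolding e_def by (auto simp: abs_le_iff)
    ultimately show ?thesis unfolding B_def by blast
  qed
  ultimately show thesis using that by blast
qed

text \<open>A point \<open>x\<close> far from all fractions with small denominators has its Dirichlet approximation of order \<open>M\<close>
  at a denominator comparable to \<open>M\<close>, outside a small exceptional set.\<close>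

lemma many_fractions:
  fixes M :: nat
  assumes \<tau>: "\<tau> > 2" and c: "0 < c" "432 * c \<le> 1 - 2 powr (2 - \<tau>)"
    and l: "0 < l" and H: "1 \<le> H" "H powr - \<tau> \<le> l"
    and M: "2 \<le> M" "l powr (1 - \<tau>) \<le> c * real M"
    and av: "avoids c \<tau> u l H"
  obtains F where "finite F" "l * (real M)\<^sup>2 / 512 \<le> real (card F)"
    "\<And>r. r \<in> F \<Longrightarrow> \<exists>x P Q. r = real_of_int P / real Q \<and> coprime P (int Q) \<and> M \<le> 64 * Q \<and> Q \<le> M
       \<and> x \<in> {u + l / 4..u + 3 * l / 4} \<and> \<bar>x - r\<bar> \<le> 64 / (real M)\<^sup>2
       \<and> (\<forall>q p. H \<le> real q \<longrightarrow> 3 * c * real q powr - \<tau> \<le> \<bar>x - real_of_int p / real q\<bar>)"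
proof -
  obtain B where B: "B \<in> sets lborel" "emeasure lborel B \<le> ennreal (l / 8)"
    "\<And>x p q. x \<in> {u..u + l} \<Longrightarrow> H \<le> real q \<Longrightarrow>
       \<bar>x - real_of_int p / real q\<bar> < 3 * c * real q powr - \<tau> \<Longrightarrow> x \<in> B"
    by (rule bad_set_small[OF \<tau> c l H, of u]) blast
  obtain B' where B': "B' \<in> sets lborel" "emeasure lborel B' \<le> ennreal (l / 8)"
    "\<And>x P Q. x \<in> {u..u + l} \<Longrightarrow> 1 \<le> real Q * l \<Longrightarrow> 64 * Q \<le> M \<Longrightarrow>
       \<bar>x - real_of_int P / real Q\<bar> \<le> 1 / (real Q * real M) \<Longrightarrow> x \<in> B'"
    by (rule small_denominators_small[OF l M(1), of u]) blast
  \<comment> \<open>Working in the middle half leaves a margin of \<open>l / 4\<close> at both ends,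
    inside which the children will fit.\<close>
  define I where "I = {u + l / 4..u + 3 * l / 4}"
  have I_sub: "I \<subseteq> {u..u + l}" using l unfolding I_def by auto
  define G where "G = I - B - B'"
  define e where "e = 64 / (real M)\<^sup>2"
  define F where "F = {real_of_int P / real Q | P Q. coprime P (int Q) \<and> M \<le> 64 * Q \<and> Q \<le> M
     \<and> (\<exists>x\<in>G. \<bar>x - real_of_int P / real Q\<bar> \<le> e)}"
  have e0: "0 < e" using M unfolding e_def by simp
  have good: "3 * c * real q powr - \<tau> \<le> \<bar>x - real_of_int p / real q\<bar>"
    if "x \<in> G" "H \<le> real q" for x p q
    using B(3)[of x q p] that I_sub unfolding G_def by force
  have approx: "\<exists>r\<in>F. \<bar>x - r\<bar> \<le> e" if x: "x \<in> G" for x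
  proof -
    obtain P :: int and Q :: nat where PQ: "coprime P (int Q)" "1 \<le> Q" "Q \<le> M"
      and near: "\<bar>x - real_of_int P / real Q\<bar> < 1 / (real Q * real M)"
      using dirichlet_nat[of M x] M by auto
    have xI: "x \<in> {u..u + l}" using x I_sub unfolding G_def by auto
    \<comment> \<open>Confronted with Dirichlet's bound, this distance gives
      \<open>c * M * Q powr (1 - \<tau>) < 1\<close>. The assumed lower bound on \<open>M\<close>
      turns it into \<open>(Q * l) powr (1 - \<tau>) < 1\<close>, whose exponent is negative; so
      \<open>Q * l\<close> is at least 1 and the set \<open>B'\<close> excludes small
      \<open>Q\<close>.\<close>
    have "c * real Q powr - \<tau> \<le> \<bar>x - real_of_int P / real Q\<bar>"
    proof (cases "real Q < H")
      case True
      then show ?thesis using avoidsD[OF av xI PQ(2)] by simp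
    next
      case False
      moreover have "c * real Q powr - \<tau> \<le> 3 * c * real Q powr - \<tau>" using c by simp
      ultimately show ?thesis using good[OF x, of Q P] by linarith
    qed
    then have "c * real Q powr - \<tau> < 1 / (real Q * real M)" using near by linarith
    then have "c * real M * (real Q powr - \<tau> * real Q) < 1"
      using PQ M by (simp add: field_simps)
    moreover have "real Q powr - \<tau> * real Q = real Q powr (1 - \<tau>)"
      using PQ by (simp add: powr_diff powr_minus field_simps)
    ultimately have "c * real M * real Q powr (1 - \<tau>) < 1" by simp
    moreover have "l powr (1 - \<tau>) * real Q powr (1 - \<tau>) \<le> c * real M * real Q powr (1 - \<tau>)"
      using M by (intro mult_right_mono) auto
    ultimately have "l powr (1 - \<tau>) * real Q powr (1 - \<tau>) < 1" by linarith
    then have *: "(real Q * l) powr (1 - \<tau>) < 1" using l by (simp add: powr_mult mult.commute)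
    have Ql: "1 \<le> real Q * l"
    proof (rule ccontr)
      assume "\<not> 1 \<le> real Q * l"
      then have "1 powr (1 - \<tau>) \<le> (real Q * l) powr (1 - \<tau>)"
        using PQ l \<tau> by (intro powr_mono2') auto
      then show False using * by simp
    qed
    have big: "M < 64 * Q"
    proof (rule ccontr)
      assume "\<not> M < 64 * Q"
      then have "x \<in> B'" using B'(3)[OF xI Ql, of P] near by auto
      then show False using x unfolding G_def by auto
    qed
    have "1 / (real Q * real M) \<le> 1 / (real M / 64 * real M)"
      using big M PQ by (intro divide_left_mono mult_right_mono) auto
    also have "\<dots> = e" unfolding e_def by (simp add: power2_eq_square)
    finally have "\<bar>x - real_of_int P / real Q\<bar> \<le> e" using near by linarith
    moreover from this have "real_of_int P / real Q \<in> F" unfolding F_def using PQ big x by (blast intro: less_imp_le)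
    ultimately show ?thesis by blast
  qed
  have fin: "finite F"
  proof (rule finite_subset)
    show "F \<subseteq> fractions_upto (real M) \<inter> {u - e..u + l + e}"
    proof
      fix r assume "r \<in> F"
      then obtain P Q x where *: "r = real_of_int P / real Q" "M \<le> 64 * Q" "Q \<le> M" "x \<in> G" "\<bar>x - r\<bar> \<le> e"
        unfolding F_def by blast
      then have "x \<in> {u..u + l}" using I_sub unfolding G_def by auto
      moreover have "1 \<le> Q" using * M by (cases Q) auto
      ultimately show "r \<in> fractions_upto (real M) \<inter> {u - e..u + l + e}"
        using * unfolding fractions_upto_def by (auto simp: abs_le_iff)
    qed
    show "finite (fractions_upto (real M) \<inter> {u - e..u + l + e})"
      using fractions_upto_card[of "real M" "u - e" "u + l + e"] M l e0 by auto
  qed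
  define N where "N = (\<Union>r\<in>F. {r - e..r + e})"
  \<comment> \<open>\<open>I\<close> has length \<open>l / 2\<close>, while \<open>B\<close> and
    \<open>B'\<close> take at most \<open>l / 8\<close> each. The intervals of length
    \<open>2 * e = 128 / M^2\<close> about \<open>F\<close> must account for the remaining
    \<open>l / 4\<close>, hence 512 = 4 * 128.\<close>
  have "I \<subseteq> N \<union> (B \<union> B')"
  proof
    fix x assume "x \<in> I"
    show "x \<in> N \<union> (B \<union> B')"
    proof (cases "x \<in> G")
      case True
      then obtain r where "r \<in> F" "\<bar>x - r\<bar> \<le> e" using approx by blast
      then show ?thesis unfolding N_def by (auto simp: abs_le_iff intro!: bexI[of _ r])
    qed (use \<open>x \<in> I\<close> in \<open>auto simp: G_def\<close>)
  qed
  moreover have Ns: "N \<in> sets lborel" unfolding N_def using fin by auto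
  ultimately have "emeasure lborel I \<le> emeasure lborel (N \<union> (B \<union> B'))"
    using B B' by (intro emeasure_mono) auto
  also have "\<dots> \<le> emeasure lborel N + (emeasure lborel B + emeasure lborel B')"
    using B B' Ns by (intro order_trans[OF emeasure_subadditive] add_mono) auto
  also have "\<dots> \<le> ennreal (real (card F) * (2 * e)) + (ennreal (l / 8) + ennreal (l / 8))"
    using emeasure_neighbourhood[OF fin, of e] e0 B B' unfolding N_def by (intro add_mono) auto
  also have "\<dots> = ennreal (real (card F) * (2 * e) + l / 4)"
    using l e0 by (simp flip: ennreal_plus)
  finally have "ennreal (l / 2) \<le> ennreal (real (card F) * (2 * e) + l / 4)"
    using l unfolding I_def by (simp add: field_simps)
  then have "l / 2 \<le> real (card F) * (2 * e) + l / 4"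
    using l e0 by (subst (asm) ennreal_le_iff) auto
  then have "l / 4 \<le> real (card F) * 128 / (real M)\<^sup>2" unfolding e_def by simp
  then have "l * (real M)\<^sup>2 / 512 \<le> real (card F)"
    using M by (simp add: field_simps)
  moreover have "\<exists>x P Q. r = real_of_int P / real Q \<and> coprime P (int Q) \<and> M \<le> 64 * Q \<and> Q \<le> M
       \<and> x \<in> {u + l / 4..u + 3 * l / 4} \<and> \<bar>x - r\<bar> \<le> 64 / (real M)\<^sup>2
       \<and> (\<forall>q p. H \<le> real q \<longrightarrow> 3 * c * real q powr - \<tau> \<le> \<bar>x - real_of_int p / real q\<bar>)"
    if r: "r \<in> F" for r
  proof -
    obtain P Q x where *: "r = real_of_int P / real Q" "coprime P (int Q)" "M \<le> 64 * Q" "Q \<le> M" "x \<in> G" "\<bar>x - r\<bar> \<le> e"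
      using r unfolding F_def by blast
    then show ?thesis using good[OF \<open>x \<in> G\<close>] unfolding e_def G_def I_def by blast
  qed
  ultimately show thesis using that[OF fin] by blast
qed

section \<open>Choosing a child interval\<close>

lemma eventually_powr_ge:
  fixes K p :: real
  assumes "p > 0"
  shows "eventually (\<lambda>M. K \<le> real M powr p) sequentially"
proof -
  define L where "L = max 1 K powr (1 / p)"
  have "K \<le> real M powr p" if "nat \<lceil>L\<rceil> \<le> M" for M
  proof -
    have "L powr p \<le> real M powr p" using that assms by (intro powr_mono2) (auto simp: L_def)
    moreover have "L powr p = max 1 K" using assms unfolding L_def by (simp add: powr_powr)
    ultimately show ?thesis by linarith
  qed
  then show ?thesis unfolding eventually_sequentially by blast
qed

text \<open>Denominators below \<open>H\<close> are settled by the parent. For the others the factor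
  3 at the good point \<open>x\<close> gives slack: while \<open>2 * c * q powr - \<tau>\<close>
  exceeds the distance from \<open>x\<close> to the child, the estimate at \<open>x\<close> carries
  over. For larger \<open>q\<close> the fraction either equals \<open>r\<close> or is repelled by
  \<open>r\<close>.\<close>

lemma child_avoids:
  fixes M :: nat
  assumes \<tau>: "\<tau> > 2" and c: "0 < c" "c \<le> 64 powr - \<tau>"
    and av: "avoids c \<tau> u l H"
    and M: "2 \<le> M" and fine: "66 / (real M)\<^sup>2 \<le> l / 4"
      "2 * c * real M \<le> (c * (real M)\<^sup>2 / 33) powr ((\<tau> - 1) / \<tau>)"
    and r: "r = real_of_int P / real Q" "coprime P (int Q)" "M \<le> 64 * Q" "Q \<le> M"
    and x: "x \<in> {u + l / 4..u + 3 * l / 4}" "\<bar>x - r\<bar> \<le> 64 / (real M)\<^sup>2"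
    and good: "\<And>q p. H \<le> real q \<Longrightarrow> 3 * c * real q powr - \<tau> \<le> \<bar>x - real_of_int p / real q\<bar>"
  defines "m \<equiv> real M powr - \<tau>"
  shows "{r + m..r + m + m} \<subseteq> {u..u + l}"
    and "avoids c \<tau> (r + m) m (real M powr (\<tau> - 1) / 4)"
proof -
  have m0: "0 < m" using M unfolding m_def by simp
  have "real M powr - \<tau> \<le> real M powr - 2" using M \<tau> by (intro powr_mono) auto
  then have m2: "m \<le> 1 / (real M)\<^sup>2"
    using M unfolding m_def by (simp add: powr_minus divide_inverse powr_numeral)
  \<comment> \<open>66 = 64 + 2: the distance from \<open>x\<close> to \<open>r\<close>, plus
    \<open>2 * m \<le> 2 / M^2\<close> from \<open>r\<close> to the far end of the child.\<close>
  have near: "\<bar>y - x\<bar> \<le> 66 / (real M)\<^sup>2" if "y \<in> {r + m..r + m + m}" for y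
  proof -
    have "\<bar>y - r\<bar> \<le> 2 * (1 / (real M)\<^sup>2)" using that m0 m2 by auto
    then show ?thesis using x(2) by (simp add: abs_le_iff)
  qed
  show sub: "{r + m..r + m + m} \<subseteq> {u..u + l}"
  proof
    fix y assume "y \<in> {r + m..r + m + m}"
    from near[OF this] show "y \<in> {u..u + l}" using x(1) fine(1) by auto
  qed
  show "avoids c \<tau> (r + m) m (real M powr (\<tau> - 1) / 4)"
    unfolding avoids_def
  proof (intro ballI allI impI)
    fix y q p assume y: "y \<in> {r + m..r + m + m}" and q: "1 \<le> q" "real q < real M powr (\<tau> - 1) / 4"
    show "c * real q powr - \<tau> \<le> \<bar>y - real_of_int p / real q\<bar>"
    proof (cases "real q < H")
      case True
      have "y \<in> {u..u + l}" using y sub by blast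
      then show ?thesis using avoidsD[OF av _ q(1) True] by blast
    next
      case False
      then have far: "3 * c * real q powr - \<tau> \<le> \<bar>x - real_of_int p / real q\<bar>" using good by simp
      consider (large) "66 / (real M)\<^sup>2 \<le> 2 * c * real q powr - \<tau>"
        | (same) "real_of_int p / real q = r"
        | (other) "2 * c * real q powr - \<tau> < 66 / (real M)\<^sup>2" "real_of_int p / real q \<noteq> r"
        by linarith
      then show ?thesis
      proof cases
        case large
        then show ?thesis using far near[OF y] by linarith
      next
        case same
        \<comment> \<open>As \<open>P / Q\<close> is reduced, \<open>Q\<close> divides
          \<open>q\<close>, so \<open>M \<le> 64 * q\<close>. Then
          \<open>c \<le> 64 powr - \<tau>\<close> bounds the required distance by \<open>m\<close>,
          the gap between \<open>r\<close> and its child.\<close>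
        have "1 \<le> Q" using r M by (cases Q) auto
        then have "real_of_int (p * int Q) = real_of_int (P * int q)"
          using same r(1) q by (simp add: field_simps)
        then have "p * int Q = P * int q" by (simp only: of_int_eq_iff)
        then have "int Q dvd P * int q" by (metis dvd_triv_right)
        then have "int Q dvd int q" using r(2) by (metis coprime_commute coprime_dvd_mult_right_iff)
        then have "Q \<le> q" using q by (simp add: dvd_imp_le)
        then have "real M \<le> 64 * real q" using r(3) by linarith
        then have "(64 * real q) powr - \<tau> \<le> m"
          unfolding m_def using M \<tau> by (intro powr_mono2') auto
        moreover have "(64 * real q) powr - \<tau> = 64 powr - \<tau> * real q powr - \<tau>" by (simp add: powr_mult)
        moreover have "c * real q powr - \<tau> \<le> 64 powr - \<tau> * real q powr - \<tau>"
          using c by (intro mult_right_mono) auto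
        ultimately have "c * real q powr - \<tau> \<le> m" by linarith
        then show ?thesis using y m0 same by auto
      next
        case other
        have Q1: "1 \<le> Q" using r M by (cases Q) auto
        \<comment> \<open>Since \<open>Q \<le> M\<close>, the fractions \<open>p / q\<close> and
          \<open>r\<close> are at least \<open>z\<close> apart. The horizon
          \<open>M powr (\<tau> - 1) / 4\<close> is chosen to make \<open>2 * m \<le> z / 2\<close>,
          so half of this gap survives at every point of the child.\<close>
        define z where "z = 1 / (real q * real M)"
        have "z \<le> 1 / (real q * real Q)" unfolding z_def
          using r Q1 q by (intro divide_left_mono mult_left_mono mult_pos_pos) auto
        also have "\<dots> \<le> \<bar>real_of_int p / real q - r\<bar>"
          using distinct_fractions_dist[of q Q p P] other q Q1 r by simp
        finally have d1: "z \<le> \<bar>real_of_int p / real q - r\<bar>" .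
        have "2 * m * (2 * real q * real M) \<le> 2 * m * (2 * (real M powr (\<tau> - 1) / 4) * real M)"
          using q m0 M by (intro mult_left_mono mult_right_mono) auto
        also have "\<dots> = 1"
          using M unfolding m_def by (simp add: powr_minus powr_diff)
        finally have "2 * m \<le> z / 2"
          using q M unfolding z_def by (simp add: field_simps)
        moreover have "\<bar>y - r\<bar> \<le> 2 * m" using y m0 by auto
        ultimately have d2: "z / 2 \<le> \<bar>y - real_of_int p / real q\<bar>"
          using d1 by linarith
        have qp: "0 < real q powr - \<tau>" using q by simp
        \<comment> \<open>What remains is \<open>2 * c * M \<le> q powr (\<tau> - 1)\<close>.
          Failure of the case \<open>large\<close> bounds \<open>q powr \<tau>\<close> from below;
          the power \<open>(\<tau> - 1) / \<tau>\<close> of that bound is what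
          \<open>fine(2)\<close> is about.\<close>
        have "2 * c * (real M)\<^sup>2 * real q powr - \<tau> < 66"
          using other M by (simp add: field_simps)
        then have "c * (real M)\<^sup>2 / 33 * real q powr - \<tau> < 1" by (simp add: mult_ac)
        then have "c * (real M)\<^sup>2 / 33 < real q powr \<tau>"
          using q by (simp add: powr_minus field_simps)
        then have "(c * (real M)\<^sup>2 / 33) powr ((\<tau> - 1) / \<tau>) \<le> (real q powr \<tau>) powr ((\<tau> - 1) / \<tau>)"
          using \<tau> c by (intro powr_mono2) auto
        also have "\<dots> = real q powr (\<tau> - 1)" using \<tau> by (simp add: powr_powr)
        finally have "2 * c * real M \<le> real q powr (\<tau> - 1)" using fine(2) by linarith
        then have "2 * c * real M * (real q * real q powr - \<tau>) \<le> real q powr (\<tau> - 1) * (real q * real q powr - \<tau>)"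
          by (intro mult_right_mono) auto
        also have "\<dots> = 1" using q by (simp add: powr_minus powr_diff)
        finally have "c * real q powr - \<tau> \<le> z / 2"
          using q M unfolding z_def by (simp add: field_simps)
        then show ?thesis using d2 by linarith
      qed
    qed
  qed
qed

section \<open>Charges and the pigeonhole choice of a child\<close>

definition charge :: "(nat \<Rightarrow> real) \<Rightarrow> (nat \<Rightarrow> real set) \<Rightarrow> real set \<Rightarrow> real" where
  "charge w U J = (\<Sum>i. if U i \<inter> J \<noteq> {} then w i else 0)"

lemma summable_charge:
  assumes "summable w" "\<And>i. 0 \<le> w i"
  shows "summable (\<lambda>i. if P i then w i else (0::real))"
  by (rule summable_comparison_test'[OF assms(1), of 0]) (use assms(2) in auto)

lemma charge_ge:
  assumes "summable w" "\<And>i. 0 \<le> w i" "U i \<inter> J \<noteq> {}"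
  shows "w i \<le> charge w U J"
  using sum_le_suminf[of "\<lambda>i. if U i \<inter> J \<noteq> {} then w i else 0" "{i}"] summable_charge[OF assms(1,2)] assms
  unfolding charge_def by auto

text \<open>The fractions whose children meet \<open>A\<close> differ pairwise by at most
  \<open>diameter A + m\<close> and are \<open>1 / D^2\<close>-separated. The bound
  \<open>2 * m * D^2 \<le> 1\<close> absorbs the contribution of \<open>m\<close> into the constant
  2.\<close>

lemma few_children_hit:
  fixes A :: "real set"
  assumes F: "F \<subseteq> fractions_upto D" and D: "1 \<le> D" and m: "0 \<le> m" "2 * m * D\<^sup>2 \<le> 1" and A: "bounded A"
  shows "real (card {r \<in> F. A \<inter> {r + m..r + m + m} \<noteq> {}}) \<le> 2 + 2 * diameter A * D\<^sup>2"
proof (cases "{r \<in> F. A \<inter> {r + m..r + m + m} \<noteq> {}} = {}")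
  case True
  then show ?thesis unfolding True using diameter_ge_0[OF A] by simp
next
  case False
  define S where "S = {r \<in> F. A \<inter> {r + m..r + m + m} \<noteq> {}}"
  define L where "L = diameter A + m"
  have L0: "0 \<le> L" using diameter_ge_0[OF A] m unfolding L_def by simp
  have close: "\<bar>r - r'\<bar> \<le> L" if "r \<in> S" "r' \<in> S" for r r'
  proof -
    obtain y y' where y: "y \<in> A" "y' \<in> A" "y \<in> {r + m..r + m + m}" "y' \<in> {r' + m..r' + m + m}"
      using \<open>r \<in> S\<close> \<open>r' \<in> S\<close> unfolding S_def by blast
    then have "\<bar>y - y'\<bar> \<le> diameter A" using diameter_bounded_bound[OF A, of y y'] by (simp add: dist_real_def)
    then show ?thesis using y unfolding L_def by auto
  qed
  obtain r0 where "r0 \<in> S" using False unfolding S_def by blast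
  then have "S \<subseteq> {r0 - L..r0 + L}" using close[of _ r0] by (force simp: abs_le_iff)
  then have "real (card S) \<le> 1 + (r0 + L - (r0 - L)) / (1 / D\<^sup>2)"
    using fractions_upto_separated[of _ D] F D L0 unfolding S_def by (intro separated_card) auto
  also have "\<dots> = 1 + 2 * m * D\<^sup>2 + 2 * diameter A * D\<^sup>2" unfolding L_def by (simp add: algebra_simps)
  finally show ?thesis using m unfolding S_def by linarith
qed

text \<open>Truncating the weights at \<open>2T\<close> loses nothing: a child of truncated charge at most \<open>T\<close> meets no
  set of weight \<open>2T\<close> or more. After truncation, sets much longer than the gaps between children cost
  only as much as the number of children they hit.\<close>

lemma select_child:
  assumes F: "finite F" "F \<subseteq> fractions_upto D" "\<kappa> * l * D\<^sup>2 \<le> real (card F)"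
    and D: "1 \<le> D" and m: "0 < m" "2 * m * D\<^sup>2 \<le> 1"
    and sub: "\<And>r. r \<in> F \<Longrightarrow> {r + m..r + m + m} \<subseteq> J"
    and w: "summable w" "\<And>i. 0 < w i"
    and U: "\<And>i. bounded (U i)" "\<And>i. diameter (U i) powr s \<le> w i"
    and s: "0 < s" "s \<le> 1" and pos: "0 < \<kappa>" "0 < l" "0 < \<rho>" "\<rho> powr (1 / s) \<le> \<kappa> / 8"
    and charge: "charge w U J \<le> \<rho> * l powr s"
    and fine: "4 * l powr s \<le> \<kappa> * l * D\<^sup>2 * m powr s"
  shows "\<exists>r\<in>F. charge w U {r + m..r + m + m} \<le> \<rho> * m powr s"
proof -
  define K where "K r = {r + m..r + m + m}" for r
  define T where "T = \<rho> * m powr s"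
  define \<epsilon> where "\<epsilon> = \<rho> * l powr s"
  have T0: "0 < T" and e0: "0 < \<epsilon>" using pos m unfolding T_def \<epsilon>_def by auto
  have w0: "0 \<le> w i" for i using w(2)[of i] by simp
  define a where "a i = (if U i \<inter> J \<noteq> {} then w i else 0)" for i
  define b where "b r i = (if U i \<inter> K r \<noteq> {} then min (w i) (2 * T) else 0)" for r i
  \<comment> \<open>\<open>C\<close> bounds the factor by which one weight is multiplied when summed
    over all children. The 2 is for the children hit by even the shortest set; the second summand is
    for long sets, whose truncated weight is estimated by \<open>2 * T\<close>.\<close>
  define C where "C = 2 + 4 * T * D\<^sup>2 * \<epsilon> powr (1 / s - 1)"
  have suma: "summable a" unfolding a_def using summable_charge[OF w(1) w0] .
  have sumb: "summable (b r)" for r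
    by (rule summable_comparison_test'[OF w(1), of 0]) (use w0 T0 in \<open>auto simp: b_def\<close>)
  have b0: "0 \<le> b r i" for r i using w0[of i] T0 unfolding b_def by auto
  have ab: "(\<Sum>r\<in>F. b r i) \<le> C * a i" for i
  proof (cases "U i \<inter> J = {}")
    case True
    then have "b r i = 0" if "r \<in> F" for r using sub[OF that] unfolding b_def K_def by auto
    then show ?thesis using True unfolding a_def by simp
  next
    case False
    have d0: "0 \<le> diameter (U i)" using diameter_ge_0[OF U(1)] .
    \<comment> \<open>A set meeting \<open>J\<close> weighs no more than the charge of
      \<open>J\<close>. As \<open>1 / s - 1\<close> is nonnegative, this turns the bound
      \<open>w i powr (1 / s)\<close> on the diameter into one linear in \<open>w i\<close>.\<close>
    have "w i \<le> \<epsilon>" using charge_ge[where U = U, OF w(1) w0 False] charge unfolding \<epsilon>_def by linarith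
    have "diameter (U i) = (diameter (U i) powr s) powr (1 / s)" using d0 s by (simp add: powr_powr)
    also have "\<dots> \<le> w i powr (1 / s)" using U(2)[of i] s by (intro powr_mono2) auto
    also have "\<dots> = w i * w i powr (1 / s - 1)" using w(2)[of i] by (simp add: powr_diff)
    also have "\<dots> \<le> w i * \<epsilon> powr (1 / s - 1)"
      using \<open>w i \<le> \<epsilon>\<close> w0[of i] s by (intro mult_left_mono powr_mono2) (auto simp: field_simps)
    finally have d: "diameter (U i) \<le> w i * \<epsilon> powr (1 / s - 1)" .
    have "(\<Sum>r\<in>F. b r i) = real (card {r \<in> F. U i \<inter> K r \<noteq> {}}) * min (w i) (2 * T)"
      unfolding b_def using F(1) by (simp add: sum.If_cases Int_def)
    also have "\<dots> \<le> (2 + 2 * diameter (U i) * D\<^sup>2) * min (w i) (2 * T)"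
      using few_children_hit[OF F(2) D less_imp_le[OF m(1)] m(2) U(1), of i] w0[of i] T0
      unfolding K_def by (intro mult_right_mono) auto
    also have "\<dots> = 2 * min (w i) (2 * T) + 2 * D\<^sup>2 * diameter (U i) * min (w i) (2 * T)"
      by (simp add: algebra_simps)
    also have "\<dots> \<le> 2 * w i + 2 * D\<^sup>2 * (w i * \<epsilon> powr (1 / s - 1)) * (2 * T)"
      using d d0 w0[of i] T0 by (intro add_mono mult_mono) auto
    also have "\<dots> = C * a i" using False unfolding C_def a_def by (simp add: algebra_simps)
    finally show ?thesis .
  qed
  have "suminf a \<le> \<epsilon>" using charge unfolding a_def charge_def \<epsilon>_def .
  have C0: "0 \<le> C" using T0 unfolding C_def by simp
  have "(\<Sum>r\<in>F. suminf (b r)) = (\<Sum>i. \<Sum>r\<in>F. b r i)"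
    by (rule suminf_sum[symmetric]) (use sumb in auto)
  also have "\<dots> \<le> (\<Sum>i. C * a i)"
    by (intro suminf_le ab summable_sum summable_mult sumb suma)
  also have "\<dots> = C * suminf a" using suma by (rule suminf_mult)
  also have "\<dots> \<le> C * \<epsilon>" using C0 \<open>suminf a \<le> \<epsilon>\<close> by (rule mult_left_mono[rotated])
  also have "\<dots> = 2 * \<epsilon> + 4 * T * D\<^sup>2 * \<epsilon> powr (1 / s)"
    using e0 unfolding C_def by (simp add: powr_diff algebra_simps)
  also have "\<epsilon> powr (1 / s) = \<rho> powr (1 / s) * l"
    using pos s unfolding \<epsilon>_def by (simp add: powr_mult powr_powr)
  also have "4 * T * D\<^sup>2 * (\<rho> powr (1 / s) * l) \<le> 4 * T * D\<^sup>2 * (\<kappa> / 8 * l)"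
    using pos T0 by (intro mult_left_mono mult_right_mono) auto
  \<comment> \<open>Each summand is at most half of the right side, the first by \<open>fine\<close>
    and the second because of the factor \<open>\<kappa> / 8\<close>.\<close>
  also have "2 * \<epsilon> + 4 * T * D\<^sup>2 * (\<kappa> / 8 * l) \<le> T * (\<kappa> * l * D\<^sup>2)"
  proof -
    have "\<rho> * (4 * l powr s) \<le> \<rho> * (\<kappa> * l * D\<^sup>2 * m powr s)" using fine pos by (intro mult_left_mono) auto
    then have "4 * \<epsilon> \<le> T * (\<kappa> * l * D\<^sup>2)" unfolding \<epsilon>_def T_def by (simp add: mult_ac)
    then show ?thesis by (simp add: algebra_simps)
  qed
  also have "\<dots> \<le> T * real (card F)" using F T0 by (intro mult_left_mono) auto
  finally have total: "(\<Sum>r\<in>F. suminf (b r)) \<le> T * real (card F)" by simp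
  have "0 < \<kappa> * l * D\<^sup>2" using pos D by auto
  then have "0 < real (card F)" using F(3) by linarith
  then have "F \<noteq> {}" by auto
  have "\<exists>r\<in>F. suminf (b r) \<le> T"
  proof (rule ccontr)
    assume "\<not> (\<exists>r\<in>F. suminf (b r) \<le> T)"
    then have "(\<Sum>r\<in>F. T) < (\<Sum>r\<in>F. suminf (b r))"
      using F(1) \<open>F \<noteq> {}\<close> by (intro sum_strict_mono) auto
    then show False using total by (simp add: mult.commute)
  qed
  then obtain r where r: "r \<in> F" "suminf (b r) \<le> T" by blast
  have "b r i = (if U i \<inter> K r \<noteq> {} then w i else 0)" for i
  proof -
    have "b r i \<le> suminf (b r)" using sum_le_suminf[OF sumb, of "{i}" r] b0 by simp
    then show ?thesis using r T0 unfolding b_def by (auto simp: min_def split: if_splits)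
  qed
  then have "charge w U (K r) = suminf (b r)" unfolding charge_def by (intro arg_cong[where f=suminf]) auto
  then show ?thesis using r unfolding K_def T_def by (metis (no_types))
qed

text \<open>The restriction \<open>s < 2 / \<tau>\<close> enters as
  \<open>0 < 2 - \<tau> * s\<close>: a constant times \<open>l * M^2\<close> children, each with a
  budget of \<open>\<rho> * M powr - (\<tau> * s)\<close>, together outgrow the charge of the parent
  once \<open>M\<close> is large.\<close>

lemma light_child:
  assumes \<tau>: "\<tau> > 2" and c: "0 < c" "432 * c \<le> 1 - 2 powr (2 - \<tau>)" "c \<le> 64 powr - \<tau>"
    and s: "0 < s" "s < 2 / \<tau>" and \<rho>: "0 < \<rho>" "\<rho> powr (1 / s) \<le> 1 / 4096"
    and w: "summable w" "\<And>i. 0 < w i"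
    and U: "\<And>i. bounded (U i)" "\<And>i. diameter (U i) powr s \<le> w i"
    and l: "0 < l" and H: "1 \<le> H" "H powr - \<tau> \<le> l"
    and av: "avoids c \<tau> u l H" and ch: "charge w U {u..u + l} \<le> \<rho> * l powr s"
  obtains M :: nat and u' m where "N \<le> M" "1 \<le> M" "m = real M powr - \<tau>" "{u'..u' + m} \<subseteq> {u..u + l}"
    "avoids c \<tau> u' m (real M powr (\<tau> - 1) / 4)"
    "real M \<le> real M powr (\<tau> - 1) / 4"
    "charge w U {u'..u' + m} \<le> \<rho> * m powr s"
    "\<exists>P Q. M \<le> 64 * Q \<and> (\<forall>y\<in>{u'..u' + m}. \<bar>y - real_of_int P / real Q\<bar> \<le> 2 * real Q powr - \<tau>)"
proof -
  define a where "a = (\<tau> - 1) / \<tau>"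
  have a: "2 * a - 1 > 0" using \<tau> unfolding a_def by (simp add: field_simps)
  have s\<tau>: "0 < 2 - \<tau> * s" using s \<tau> by (simp add: field_simps)
  have s1: "s \<le> 1"
  proof -
    have "2 / \<tau> \<le> 1" using \<tau> by simp
    then show ?thesis using s by linarith
  qed
  \<comment> \<open>After the lower bound on \<open>M\<close>, the requirements serve in order:
    \<open>many_fractions\<close>; the fit of a child in its parent (264 = 4 * 66);
    \<open>fine(2)\<close> of \<open>child_avoids\<close>; both the spacing of the children and a
    new horizon of at least \<open>M\<close>; and \<open>fine\<close> of \<open>select_child\<close>
    for \<open>\<kappa> = 1 / 512\<close> (2048 = 4 * 512).\<close>
  have "eventually (\<lambda>M. max N 2 \<le> M \<and> l powr (1 - \<tau>) / c \<le> real M powr 1 \<and> 264 / l \<le> real M powr 2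
      \<and> 2 * c / (c / 33) powr a \<le> real M powr (2 * a - 1) \<and> 4 \<le> real M powr (\<tau> - 2)
      \<and> 2048 * l powr (s - 1) \<le> real M powr (2 - \<tau> * s)) sequentially"
    using \<tau> a s\<tau> by (intro eventually_conj eventually_powr_ge eventually_ge_at_top) auto
  then obtain M where M: "max N 2 \<le> M" "l powr (1 - \<tau>) / c \<le> real M powr 1" "264 / l \<le> real M powr 2"
      "2 * c / (c / 33) powr a \<le> real M powr (2 * a - 1)" "4 \<le> real M powr (\<tau> - 2)"
      "2048 * l powr (s - 1) \<le> real M powr (2 - \<tau> * s)"
    using eventually_happens by fastforce
  have M2: "2 \<le> M" "N \<le> M" using M by auto
  have c1: "l powr (1 - \<tau>) \<le> c * real M" using M(2) M2 c by (simp add: field_simps)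
  have c2: "66 / (real M)\<^sup>2 \<le> l / 4" using M(3) M2 l by (simp add: field_simps powr_numeral)
  have c3: "2 * c * real M \<le> (c * (real M)\<^sup>2 / 33) powr a"
  proof -
    have "2 * c \<le> real M powr (2 * a - 1) * (c / 33) powr a" using M(4) c by (simp add: field_simps)
    then have "2 * c * real M \<le> real M powr (2 * a - 1) * (c / 33) powr a * real M" by (intro mult_right_mono) auto
    also have "\<dots> = (c / 33) powr a * (real M powr 2) powr a"
      using M2 by (simp add: powr_powr powr_diff del: powr_numeral)
    also have "\<dots> = (c * (real M)\<^sup>2 / 33) powr a"
      using c M2 by (simp add: powr_mult[symmetric] powr_numeral)
    finally show ?thesis .
  qed
  define m where "m = real M powr - \<tau>"
  have m0: "0 < m" using M2 unfolding m_def by simp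
  have mM: "2 * m * (real M)\<^sup>2 \<le> 1"
  proof -
    have "m * (real M)\<^sup>2 = 1 / real M powr (\<tau> - 2)"
      using M2 unfolding m_def by (simp add: powr_minus powr_diff powr_numeral field_simps)
    also have "\<dots> \<le> 1 / 4" using M(5) M2 by (intro divide_left_mono) auto
    finally show ?thesis by simp
  qed
  have HM: "real M \<le> real M powr (\<tau> - 1) / 4"
  proof -
    have "real M * 4 \<le> real M * real M powr (\<tau> - 2)" using M(5) by (intro mult_left_mono) auto
    also have "\<dots> = real M powr (\<tau> - 1)" using M2 by (simp add: powr_diff power2_eq_square powr_numeral)
    finally show ?thesis by simp
  qed
  have fine: "4 * l powr s \<le> 1 / 512 * l * (real M)\<^sup>2 * m powr s"
  proof -
    have "l powr s = l powr (s - 1) * l" using l by (simp add: powr_diff)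
    then have "2048 * l powr s = (2048 * l powr (s - 1)) * l" by simp
    also have "\<dots> \<le> real M powr (2 - \<tau> * s) * l" using M(6) l by (intro mult_right_mono) auto
    also have "\<dots> = l * (real M)\<^sup>2 * m powr s"
    proof -
      have "m powr s = real M powr - (\<tau> * s)" unfolding m_def by (simp add: powr_powr)
      also have "\<dots> = inverse (real M powr (\<tau> * s))" by (rule powr_minus)
      finally have "m powr s = inverse (real M powr (\<tau> * s))" .
      then show ?thesis using M2 by (simp add: powr_diff powr_numeral field_simps)
    qed
    finally show ?thesis by simp
  qed
  obtain F where F: "finite F" "l * (real M)\<^sup>2 / 512 \<le> real (card F)"
    and F_good: "\<And>r. r \<in> F \<Longrightarrow> \<exists>x P Q. r = real_of_int P / real Q \<and> coprime P (int Q) \<and> M \<le> 64 * Q \<and> Q \<le> M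
       \<and> x \<in> {u + l / 4..u + 3 * l / 4} \<and> \<bar>x - r\<bar> \<le> 64 / (real M)\<^sup>2
       \<and> (\<forall>q p. H \<le> real q \<longrightarrow> 3 * c * real q powr - \<tau> \<le> \<bar>x - real_of_int p / real q\<bar>)"
    using many_fractions[OF \<tau> c(1,2) l H M2(1) c1 av] by blast
  have child: "{r + m..r + m + m} \<subseteq> {u..u + l} \<and> avoids c \<tau> (r + m) m (real M powr (\<tau> - 1) / 4)" if r: "r \<in> F" for r
  proof -
    obtain x P Q where *: "r = real_of_int P / real Q" "coprime P (int Q)" "M \<le> 64 * Q" "Q \<le> M"
        "x \<in> {u + l / 4..u + 3 * l / 4}" "\<bar>x - r\<bar> \<le> 64 / (real M)\<^sup>2"
        "\<And>q p. H \<le> real q \<Longrightarrow> 3 * c * real q powr - \<tau> \<le> \<bar>x - real_of_int p / real q\<bar>"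
      using F_good[OF r] by blast
    show ?thesis unfolding m_def
      using child_avoids[OF \<tau> c(1,3) av M2(1) c2 c3[unfolded a_def] *] by blast
  qed
  have Fsub: "F \<subseteq> fractions_upto (real M)"
  proof
    fix r assume "r \<in> F"
    then obtain P Q where "r = real_of_int P / real Q" "M \<le> 64 * Q" "Q \<le> M" using F_good by blast
    moreover from this have "1 \<le> Q" using M2 by linarith
    ultimately show "r \<in> fractions_upto (real M)" unfolding fractions_upto_def by auto
  qed
  \<comment> \<open>The density 1 / 512 comes from \<open>many_fractions\<close>, and 4096 = 8 * 512
    matches the condition on \<rho> in \<open>select_child\<close>.\<close>
  obtain r where r: "r \<in> F" "charge w U {r + m..r + m + m} \<le> \<rho> * m powr s"
    using select_child[OF F(1) Fsub, of "1 / 512" l m "{u..u + l}" w U s \<rho>] F(2) M2 m0 mM child w U s s1 l \<rho> ch fine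
    by auto
  obtain P Q where PQ: "r = real_of_int P / real Q" "M \<le> 64 * Q" "Q \<le> M"
    using F_good[OF r(1)] by blast
  \<comment> \<open>Points of the child are within \<open>2 * m\<close> of \<open>P / Q\<close>, and
    \<open>Q \<le> M\<close> gives \<open>m \<le> Q powr - \<tau>\<close>; this is the source of the
    constant 2 in \<open>exactly_approximable\<close>.\<close>
  have "\<bar>y - real_of_int P / real Q\<bar> \<le> 2 * real Q powr - \<tau>" if "y \<in> {r + m..r + m + m}" for y
  proof -
    have "1 \<le> Q" using PQ M2 by linarith
    then have "m \<le> real Q powr - \<tau>" unfolding m_def using PQ M2 \<tau> by (intro powr_mono2') auto
    then show ?thesis using that PQ(1) m0 by auto
  qed
  then have ex: "\<exists>P Q. M \<le> 64 * Q \<and> (\<forall>y\<in>{r + m..r + m + m}. \<bar>y - real_of_int P / real Q\<bar> \<le> 2 * real Q powr - \<tau>)"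
    using PQ(2) by blast
  show thesis
    using that[of M m "r + m"] M2 m_def child[OF r(1)] HM r(2) ex by simp
qed

section \<open>Nested intervals and a point missed by a light family\<close>

definition exactly_approximable :: "real \<Rightarrow> real set" where
  "exactly_approximable \<tau> = {x. (\<exists>c>0. \<forall>q p. 1 \<le> q \<longrightarrow> c * real q powr - \<tau> \<le> \<bar>x - real_of_int p / real q\<bar>)
     \<and> (\<forall>N. \<exists>q\<ge>N. \<exists>p. \<bar>x - real_of_int p / real q\<bar> \<le> 2 * real q powr - \<tau>)}"

lemma light_families_do_not_cover:
  assumes \<tau>: "\<tau> > 2" and s: "0 < s" "s < 2 / \<tau>" and \<rho>: "0 < \<rho>" "\<rho> powr (1 / s) \<le> 1 / 4096"
    and w: "summable w" "\<And>i. 0 < w i" "suminf w \<le> \<rho>"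
    and U: "\<And>i. bounded (U i)" "\<And>i. diameter (U i) powr s \<le> w i"
  obtains x where "x \<in> {0..1} \<inter> exactly_approximable \<tau>" "x \<notin> (\<Union>i. U i)"
proof -
  define c where "c = min ((1 - 2 powr (2 - \<tau>)) / 432) (64 powr - \<tau>)"
  have "2 powr (2 - \<tau>) < 2 powr 0" using \<tau> by (intro powr_less_mono) auto
  then have "0 < c" unfolding c_def by auto
  moreover have "c \<le> (1 - 2 powr (2 - \<tau>)) / 432" unfolding c_def by (rule min.cobounded1)
  then have "432 * c \<le> 1 - 2 powr (2 - \<tau>)" by simp
  moreover have "c \<le> 64 powr - \<tau>" unfolding c_def by (rule min.cobounded2)
  ultimately have c: "0 < c" "432 * c \<le> 1 - 2 powr (2 - \<tau>)" "c \<le> 64 powr - \<tau>" by auto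
  \<comment> \<open>The maximum with 1 gives the root, labelled \<open>M = 0\<close>, the horizon 1,
    where \<open>avoids\<close> holds trivially.\<close>
  define h where "h M = max 1 (real M powr (\<tau> - 1) / 4)" for M :: nat
  define node where "node = (\<lambda>(M, u, l). 0 < l \<and> h M powr - \<tau> \<le> l \<and> avoids c \<tau> u l (h M)
     \<and> charge w U {u..u + l} \<le> \<rho> * l powr s)"
  \<comment> \<open>\<open>Suc k \<le> M'\<close> drives the lengths to 0 and, with
    \<open>real M' \<le> h M'\<close>, the horizons to infinity.\<close>
  define edge where "edge = (\<lambda>k (M::nat, u, l) (M', u', l'). Suc k \<le> M' \<and> l' = real M' powr - \<tau> \<and> {u'..u' + l'} \<subseteq> {u..u + l}
    \<and> real M' \<le> h M'
    \<and> (\<exists>P Q. M' \<le> 64 * Q \<and> (\<forall>y\<in>{u'..u' + l'}. \<bar>y - real_of_int P / real Q\<bar> \<le> 2 * real Q powr - \<tau>)))"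
  have "\<exists>f. \<forall>k. (node (f k) \<and> (k = 0 \<longrightarrow> f k = (0, 0, 1))) \<and> edge k (f k) (f (Suc k))"
  proof (rule dependent_nat_choice)
    have "charge w U {0..0 + 1} \<le> suminf w" unfolding charge_def
      using w by (intro suminf_le summable_charge) (auto simp: less_imp_le)
    then have "node (0, 0, 1)" unfolding node_def h_def using w(3) by (auto simp: avoids_def)
    then show "\<exists>x. node x \<and> ((0::nat) = 0 \<longrightarrow> x = (0, 0, 1))" by blast
  next
    fix x :: "nat \<times> real \<times> real" and k :: nat
    assume "node x \<and> (k = 0 \<longrightarrow> x = (0, 0, 1))"
    then obtain M u l where x: "x = (M, u, l)" and n: "0 < l" "h M powr - \<tau> \<le> l"
        "avoids c \<tau> u l (h M)" "charge w U {u..u + l} \<le> \<rho> * l powr s"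
      unfolding node_def by auto
    have "1 \<le> h M" unfolding h_def by simp
    obtain M' :: nat and u' m where M': "Suc k \<le> M'" "1 \<le> M'" "m = real M' powr - \<tau>"
        "{u'..u' + m} \<subseteq> {u..u + l}"
        "avoids c \<tau> u' m (real M' powr (\<tau> - 1) / 4)" "real M' \<le> real M' powr (\<tau> - 1) / 4"
        "charge w U {u'..u' + m} \<le> \<rho> * m powr s"
        "\<exists>P Q. M' \<le> 64 * Q \<and> (\<forall>y\<in>{u'..u' + m}. \<bar>y - real_of_int P / real Q\<bar> \<le> 2 * real Q powr - \<tau>)"
      by (rule light_child[OF \<tau> c s \<rho> w(1,2) U n(1) \<open>1 \<le> h M\<close> n(2-4), of "Suc k"])
    have "1 \<le> real M'" using M'(2) by simp
    then have h: "h M' = real M' powr (\<tau> - 1) / 4" unfolding h_def using M'(6) by simp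
    have "h M' powr - \<tau> \<le> m" unfolding h M'(3) using M'(2,6) \<tau> by (intro powr_mono2') auto
    moreover have "0 < m" unfolding M'(3) using M'(2) by simp
    ultimately have "node (M', u', m)" unfolding node_def using M'(5,7) by (simp only: h split)
    moreover have "edge k x (M', u', m)"
      unfolding edge_def x using M'(1,3,4,6,8) by (simp only: h split)
    ultimately show "\<exists>y. (node y \<and> (Suc k = 0 \<longrightarrow> y = (0, 0, 1))) \<and> edge k x y" by blast
  qed
  then obtain f where f: "\<And>k. node (f k)" "\<And>k. edge k (f k) (f (Suc k))" "f 0 = (0, 0, 1)" by blast
  define M where "M k = fst (f k)" for k
  define u where "u k = fst (snd (f k))" for k
  define l where "l k = snd (snd (f k))" for k
  have fk: "f k = (M k, u k, l k)" for k unfolding M_def u_def l_def by simp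
  have l0: "0 < l k" and av: "avoids c \<tau> (u k) (l k) (h (M k))"
    and ch: "charge w U {u k..u k + l k} \<le> \<rho> * l k powr s" for k
    using f(1)[of k] unfolding node_def fk by auto
  have Mk: "Suc k \<le> M (Suc k)" and lk: "l (Suc k) = real (M (Suc k)) powr - \<tau>"
    and sub: "{u (Suc k)..u (Suc k) + l (Suc k)} \<subseteq> {u k..u k + l k}"
    and hM: "real (M (Suc k)) \<le> h (M (Suc k))"
    and ap: "\<exists>P Q. M (Suc k) \<le> 64 * Q \<and> (\<forall>y\<in>{u (Suc k)..u (Suc k) + l (Suc k)}. \<bar>y - real_of_int P / real Q\<bar> \<le> 2 * real Q powr - \<tau>)" for k
    using f(2)[of k] unfolding edge_def fk split by blast+
  define J where "J k = {u k..u k + l k}" for k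
  have "decseq J" using sub unfolding J_def decseq_Suc_iff by auto
  then have "\<Inter> (range J) \<noteq> {}"
    using l0 by (intro compact_nest) (auto simp: J_def less_imp_le decseq_def)
  then obtain x where x: "\<And>k. x \<in> J k" by auto
  have "x \<in> {0..1}" using x[of 0] f(3) unfolding J_def u_def l_def by simp
  moreover have "x \<in> exactly_approximable \<tau>"
    unfolding exactly_approximable_def
  proof (intro CollectI conjI)
    \<comment> \<open>By stage \<open>Suc q\<close> the horizon is at least \<open>q + 1\<close>, so
      the denominator \<open>q\<close> has been dealt with.\<close>
    have "c * real q powr - \<tau> \<le> \<bar>x - real_of_int p / real q\<bar>" if "1 \<le> q" for q p
    proof (rule avoidsD[OF av _ that])
      show "x \<in> {u (Suc q)..u (Suc q) + l (Suc q)}" using x[of "Suc q"] unfolding J_def .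
      show "real q < h (M (Suc q))" using Mk[of q] hM[of q] by linarith
    qed
    then show "\<exists>c>0. \<forall>q p. 1 \<le> q \<longrightarrow> c * real q powr - \<tau> \<le> \<bar>x - real_of_int p / real q\<bar>"
      using c(1) by blast
    show "\<forall>N. \<exists>q\<ge>N. \<exists>p. \<bar>x - real_of_int p / real q\<bar> \<le> 2 * real q powr - \<tau>"
    proof
      fix N
      \<comment> \<open>The denominators are only known to be at least \<open>M / 64\<close>, hence
        the stage \<open>Suc (64 * N)\<close>.\<close>
      obtain P Q where "M (Suc (64 * N)) \<le> 64 * Q" "\<bar>x - real_of_int P / real Q\<bar> \<le> 2 * real Q powr - \<tau>"
        using ap[of "64 * N"] x[of "Suc (64 * N)"] unfolding J_def by blast
      moreover from this have "N \<le> Q" using Mk[of "64 * N"] by linarith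
      ultimately show "\<exists>q\<ge>N. \<exists>p. \<bar>x - real_of_int p / real q\<bar> \<le> 2 * real q powr - \<tau>" by blast
    qed
  qed
  moreover have "x \<notin> U i" for i
  proof
    assume "x \<in> U i"
    have w0: "0 \<le> w i" for i using w(2)[of i] by simp
    \<comment> \<open>A set containing \<open>x\<close> meets every interval of the chain, so its
      weight lies below all the budgets \<open>\<rho> * l powr s\<close>. These tend to 0, against
      positivity of the weight.\<close>
    have wi: "w i \<le> \<rho> * real (Suc k) powr - (\<tau> * s)" for k
    proof -
      have "U i \<inter> {u (Suc k)..u (Suc k) + l (Suc k)} \<noteq> {}" using \<open>x \<in> U i\<close> x[of "Suc k"] unfolding J_def by blast
      then have "w i \<le> \<rho> * l (Suc k) powr s"
        using charge_ge[where U = U, OF w(1) w0] ch[of "Suc k"] order_trans by blast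
      also have "l (Suc k) powr s = real (M (Suc k)) powr - (\<tau> * s)" unfolding lk by (simp add: powr_powr)
      also have "\<rho> * \<dots> \<le> \<rho> * real (Suc k) powr - (\<tau> * s)"
        using Mk[of k] \<rho> \<tau> s by (intro mult_left_mono powr_mono2') auto
      finally show ?thesis .
    qed
    have "eventually (\<lambda>n. 1 \<le> n \<and> \<rho> / w i + 1 \<le> real n powr (\<tau> * s)) sequentially"
      using \<tau> s by (intro eventually_conj eventually_powr_ge eventually_ge_at_top) auto
    then obtain n where n: "1 \<le> n" "\<rho> / w i + 1 \<le> real n powr (\<tau> * s)"
      using eventually_happens by fastforce
    then obtain k where k: "n = Suc k" by (cases n) auto
    have "\<rho> + w i \<le> w i * real n powr (\<tau> * s)" using n w(2)[of i] by (simp add: field_simps)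
    also have "\<dots> \<le> \<rho> * real (Suc k) powr - (\<tau> * s) * real n powr (\<tau> * s)"
      using wi[of k] by (intro mult_right_mono) auto
    also have "\<dots> = \<rho>" unfolding k by (simp add: powr_minus)
    finally show False using w(2)[of i] by simp
  qed
  ultimately show thesis using that[of x] by blast
qed

section \<open>Hausdorff measure\<close>

text \<open>A cover of small weight for \<open>s\<close> is also light for an exponent
  \<open>t\<close> strictly between \<open>s\<close> and \<open>2 / \<tau>\<close>, because
  diameters are at most 1; hence it misses a point. Passing to \<open>t\<close> also makes the
  exponent positive when \<open>s = 0\<close>.\<close>

lemma hausdorff_null_exponent_ge:
  fixes S :: "real set"
  assumes \<tau>: "\<tau> > 2" and S: "{0..1} \<inter> exactly_approximable \<tau> \<subseteq> S"
    and s: "0 \<le> s" and null: "hausdorff_measure s S = 0"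
  shows "2 / \<tau> \<le> s"
proof (rule ccontr)
  assume "\<not> 2 / \<tau> \<le> s"
  define t where "t = (s + 2 / \<tau>) / 2"
  have t: "0 < t" "s < t" "t < 2 / \<tau>" using \<open>\<not> 2 / \<tau> \<le> s\<close> s unfolding t_def by auto
  define \<rho> :: real where "\<rho> = (1 / 4096) powr t"
  have \<rho>: "0 < \<rho>" "\<rho> powr (1 / t) \<le> 1 / 4096" using t unfolding \<rho>_def by (auto simp: powr_powr)
  have "hausdorff_premeasure s 1 S \<le> hausdorff_measure s S"
    unfolding hausdorff_measure_def by (rule SUP_upper) auto
  then have "(INF U \<in> delta_covers 1 S. \<Sum>i. diam_weight s (U i)) < ennreal (\<rho> / 2)"
    using null \<rho> unfolding hausdorff_premeasure_def by (simp add: ennreal_zero_less_divide)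
  then obtain U where U: "U \<in> delta_covers 1 S" and small: "(\<Sum>i. diam_weight s (U i)) < ennreal (\<rho> / 2)"
    unfolding INF_less_iff by blast
  have bdd: "bounded (U i)" and diam: "diameter (U i) \<le> 1" for i using U unfolding delta_covers_def by auto
  have weight: "ennreal (diameter (U i) powr t) \<le> diam_weight s (U i)" for i
  proof -
    have d: "0 \<le> diameter (U i)" using diameter_ge_0[OF bdd] .
    show ?thesis unfolding diam_weight_def
      using powr_mono'[of s t "diameter (U i)"] powr_mono'[of 0 t "diameter (U i)"] d diam[of i] t s
      by (auto intro!: ennreal_leI simp: powr_le1 simp flip: ennreal_1)
  qed
  have "(\<Sum>i. ennreal (diameter (U i) powr t)) \<le> (\<Sum>i. diam_weight s (U i))"
    by (intro suminf_le weight) auto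
  then have less: "(\<Sum>i. ennreal (diameter (U i) powr t)) < ennreal (\<rho> / 2)" using small by (rule le_less_trans)
  then have sum: "summable (\<lambda>i. diameter (U i) powr t)"
    by (intro summable_suminf_not_top) auto
  then have le: "(\<Sum>i. diameter (U i) powr t) \<le> \<rho> / 2"
    using less by (subst (asm) suminf_ennreal2) (auto simp: ennreal_less_iff suminf_nonneg)
  \<comment> \<open>Empty sets and single points have \<open>diameter powr t = 0\<close>, but
    weights must be positive. Half of \<rho> is therefore spread geometrically over the
    family.\<close>
  define w where "w i = diameter (U i) powr t + \<rho> / 2 * (1 / 2) ^ Suc i" for i
  have geo: "(\<lambda>i. \<rho> / 2 * (1 / 2) ^ Suc i) sums (\<rho> / 2 * 1)" by (intro sums_mult power_half_series)
  have "w sums ((\<Sum>i. diameter (U i) powr t) + \<rho> / 2 * 1)"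
    unfolding w_def by (intro sums_add summable_sums sum geo)
  then have "summable w" "suminf w \<le> \<rho>" using le by (auto simp: sums_iff)
  moreover have "0 < w i" "diameter (U i) powr t \<le> w i" for i
    using \<rho> unfolding w_def by (auto intro!: add_nonneg_pos)
  ultimately obtain x where "x \<in> {0..1} \<inter> exactly_approximable \<tau>" "x \<notin> (\<Union>i. U i)"
    using light_families_do_not_cover[OF \<tau> t(1,3) \<rho>, of w U] bdd by blast
  then show False using S U unfolding delta_covers_def by blast
qed

section \<open>Null sets of Hausdorff measures\<close>

lemma hausdorff_measure_mono:
  assumes "S \<subseteq> T"
  shows "hausdorff_measure s S \<le> hausdorff_measure s T"
  unfolding hausdorff_measure_def hausdorff_premeasure_def
  using assms by (intro SUP_mono' INF_superset_mono) (auto simp: delta_covers_def)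

lemma hausdorff_measure_null_negligible:
  fixes S :: "real set"
  assumes "hausdorff_measure 1 S = 0"
  shows "negligible S"
  unfolding negligible_outer
proof (intro allI impI)
  fix e :: real assume "0 < e"
  have "hausdorff_premeasure 1 1 S \<le> hausdorff_measure 1 S"
    unfolding hausdorff_measure_def by (rule SUP_upper) auto
  then have "(INF U \<in> delta_covers 1 S. \<Sum>i. diam_weight 1 (U i)) < ennreal (e / 2)"
    using assms \<open>0 < e\<close> unfolding hausdorff_premeasure_def by (simp add: ennreal_zero_less_divide)
  then obtain U where U: "U \<in> delta_covers 1 S" and small: "(\<Sum>i. diam_weight 1 (U i)) < ennreal (e / 2)"
    unfolding INF_less_iff by blast
  have bdd: "bounded (U i)" for i using U unfolding delta_covers_def by auto
  \<comment> \<open>Covering sets need not be measurable. Each nonempty one is enlarged to a closed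
    interval of twice its diameter, which explains the bound \<open>e / 2\<close> on the
    weights.\<close>
  define V where "V i = (if U i = {} then {} else cball (SOME x. x \<in> U i) (diameter (U i)))" for i
  have sub: "U i \<subseteq> V i" for i
  proof
    fix y assume y: "y \<in> U i"
    then have "(SOME x. x \<in> U i) \<in> U i" by (rule someI)
    then show "y \<in> V i" using y diameter_bounded_bound[OF bdd] unfolding V_def by auto
  qed
  have Vm: "V i \<in> sets lborel" for i unfolding V_def by auto
  have V: "emeasure lborel (V i) = 2 * diam_weight 1 (U i)" for i
    using diameter_ge_0[OF bdd, of i] unfolding V_def diam_weight_def
    by (auto simp: cball_eq_atLeastAtMost ennreal_mult)
  have "emeasure lborel (\<Union>i. V i) \<le> (\<Sum>i. emeasure lborel (V i))"
    using Vm by (intro emeasure_subadditive_countably) auto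
  also have "\<dots> = 2 * (\<Sum>i. diam_weight 1 (U i))" unfolding V by (rule ennreal_suminf_cmult)
  also have "\<dots> < 2 * ennreal (e / 2)" using small by (simp add: ennreal_mult_strict_left_mono)
  also have "\<dots> = ennreal e" using \<open>0 < e\<close> by (subst ennreal_numeral[symmetric], subst ennreal_mult[symmetric]) auto
  finally have less: "emeasure lborel (\<Union>i. V i) < ennreal e" .
  have "(\<Union>i. V i) \<in> sets lborel" using Vm by auto
  then have "(\<Union>i. V i) \<in> lmeasurable" using less unfolding fmeasurable_def by (auto intro: less_trans)
  moreover have "measure lebesgue (\<Union>i. V i) < e"
    using enn2real_less_iff[OF less_trans[OF less ennreal_less_top]] less \<open>(\<Union>i. V i) \<in> sets lborel\<close>
    unfolding measure_def by simp
  moreover have "S \<subseteq> (\<Union>i. V i)" using U sub unfolding delta_covers_def by blast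
  ultimately show "\<exists>T. S \<subseteq> T \<and> T \<in> lmeasurable \<and> measure lebesgue T < e" by blast
qed

text \<open>The intervals about fractions of denominator \<open>q\<close> weigh
  \<open>(q + 1) * (2 * q powr - t) powr s\<close>, of order \<open>q powr (1 - t * s)\<close>,
  which is summable for \<open>t * s > 2\<close>. Tails of the series are arbitrarily fine covers of
  arbitrarily small weight.\<close>

lemma hausdorff_measure_limsup_null:
  assumes s: "0 < s" and ts: "2 < t * s"
    and S: "\<And>x N. x \<in> S \<Longrightarrow> \<exists>q\<ge>N. \<exists>p\<le>q. \<bar>x - real p / real q\<bar> \<le> real q powr - t"
  shows "hausdorff_measure s S = 0"
proof -
  have t: "0 < t" using s ts by (metis less_trans zero_less_mult_pos2 zero_less_numeral)
  define r where "r q = real q powr - t" for q :: nat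
  define g where "g q = (real q + 1) * (2 * r q) powr s" for q
  have g0: "0 \<le> g q" for q unfolding g_def by simp
  have "summable (\<lambda>q. 2 * 2 powr s * real q powr (1 - t * s))"
    using ts by (intro summable_mult) (auto simp: summable_real_powr_iff)
  then have sum: "summable g"
  proof (rule summable_comparison_test'[of _ 1])
    fix q :: nat assume q: "1 \<le> q"
    have "g q = (real q + 1) * (2 powr s * real q powr - (t * s))" unfolding g_def r_def by (simp add: powr_mult powr_powr)
    also have "\<dots> \<le> (2 * real q) * (2 powr s * real q powr - (t * s))" using q by (intro mult_right_mono) auto
    also have "\<dots> = 2 * 2 powr s * real q powr (1 - t * s)"
      using q powr_add[of "real q" 1 "- (t * s)"] by simp
    finally show "norm (g q) \<le> 2 * 2 powr s * real q powr (1 - t * s)" using g0[of q] by simp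
  qed
  have "hausdorff_premeasure s \<delta> S \<le> ennreal \<epsilon>" if "0 < \<delta>" "0 < \<epsilon>" for \<delta> \<epsilon>
  proof -
    obtain N1 where N1: "\<And>n. N1 \<le> n \<Longrightarrow> norm (\<Sum>i. g (i + n)) < \<epsilon>" using suminf_exist_split[OF \<open>0 < \<epsilon>\<close> sum] by blast
    obtain N2 where N2: "\<And>q. N2 \<le> q \<Longrightarrow> 2 / \<delta> \<le> real q powr t"
      using eventually_powr_ge[OF t, of "2 / \<delta>"] unfolding eventually_sequentially by blast
    define N where "N = max 1 (max N1 N2)"
    have small: "2 * r q \<le> \<delta>" if "N \<le> q" for q
      using N2[of q] that \<open>0 < \<delta>\<close> unfolding N_def r_def by (simp add: powr_minus field_simps)
    \<comment> \<open>Pairs out of range receive the empty set, of weight 0, so that all pairs can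
      be enumerated by \<open>prod_decode\<close>.\<close>
    define V where "V = (\<lambda>(q, p). if N \<le> q \<and> p \<le> q then cball (real p / real q) (r q) else {})"
    have r0: "0 \<le> r q" for q unfolding r_def by simp
    have "(\<lambda>i. V (prod_decode i)) \<in> delta_covers \<delta> S"
      unfolding delta_covers_def
    proof (intro CollectI conjI allI subsetI)
      fix x assume "x \<in> S"
      from S[OF this, of N] obtain q p where "N \<le> q" "p \<le> q" "\<bar>x - real p / real q\<bar> \<le> real q powr - t" by blast
      then have "x \<in> V (prod_decode (prod_encode (q, p)))"
        unfolding V_def r_def by (simp add: dist_real_def abs_minus_commute)
      then show "x \<in> (\<Union>i. V (prod_decode i))" by blast
    next
      fix i
      obtain q p where i: "prod_decode i = (q, p)" by fastforce
      show "bounded (V (prod_decode i))" "diameter (V (prod_decode i)) \<le> \<delta>"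
        using small[of q] r0[of q] \<open>0 < \<delta>\<close> unfolding i V_def by (auto simp: diameter_cball)
    qed
    then have "hausdorff_premeasure s \<delta> S \<le> (\<Sum>i. diam_weight s (V (prod_decode i)))"
      unfolding hausdorff_premeasure_def by (rule INF_lower)
    also have "\<dots> = (\<Sum>q. \<Sum>p. diam_weight s (V (q, p)))"
      by (rule suminf_ennreal_2dimen[of _ "\<lambda>x. diam_weight s (V x)"]) simp
    also have "\<dots> = (\<Sum>q. ennreal (if N \<le> q then g q else 0))"
    proof (rule arg_cong[where f = suminf], rule ext)
      fix q
      have "(\<Sum>p. diam_weight s (V (q, p))) = (\<Sum>p\<in>{..q}. diam_weight s (V (q, p)))"
        by (rule suminf_finite) (auto simp: V_def diam_weight_def)
      also have "\<dots> = (\<Sum>p\<in>{..q}. ennreal (if N \<le> q then (2 * r q) powr s else 0))"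
        using s r0[of q] by (intro sum.cong) (auto simp: V_def diam_weight_def diameter_cball)
      also have "\<dots> = ennreal (if N \<le> q then g q else 0)"
        by (auto simp: g_def ennreal_mult ennreal_of_nat_eq_real_of_nat add.commute)
      finally show "(\<Sum>p. diam_weight s (V (q, p))) = ennreal (if N \<le> q then g q else 0)" .
    qed
    also have "\<dots> = ennreal (\<Sum>q. if N \<le> q then g q else 0)"
      using g0 by (intro suminf_ennreal2 summable_comparison_test'[OF sum, of 0]) auto
    also have "(\<Sum>q. if N \<le> q then g q else 0) = (\<Sum>i. g (i + N))"
      using g0 by (subst suminf_split_initial_segment[of _ N]) (auto intro!: summable_comparison_test'[OF sum, of 0])
    also have "\<dots> \<le> \<epsilon>" using N1[of N] unfolding N_def by (simp add: abs_less_iff le_max_iff_disj)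
    finally show ?thesis by (simp add: ennreal_leI)
  qed
  then have "hausdorff_premeasure s \<delta> S = 0" if "0 < \<delta>" for \<delta>
    using ennreal_le_epsilon[of 0 "hausdorff_premeasure s \<delta> S"] that by simp
  then show ?thesis unfolding hausdorff_measure_def by simp
qed

section \<open>Continued fractions and approximation by fractions\<close>

lemma cf_denom_mono:
  assumes "\<theta> \<notin> \<rat>"
  shows "cf_denom \<theta> n \<le> cf_denom \<theta> (Suc n)"
proof (cases n)
  case 0
  then show ?thesis using cf_digit_ge_1[OF assms, of 0] by simp
next
  case (Suc m)
  have "1 * cf_denom \<theta> n \<le> cf_digit \<theta> (Suc n) * cf_denom \<theta> n"
    using cf_digit_ge_1[OF assms, of n] cf_denom_ge[OF assms, of n] by (intro mult_right_mono) auto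
  moreover have "cf_denom \<theta> (Suc n) = cf_digit \<theta> (Suc n) * cf_denom \<theta> n + cf_denom \<theta> m"
    unfolding Suc by simp
  ultimately show ?thesis using cf_denom_ge[OF assms, of m] by linarith
qed

text \<open>The distance equals \<open>1 / (q (Suc n) * D)\<close> with
  \<open>D = c * q (Suc n) + q n\<close> and \<open>c\<close> the complete quotient. All three
  bounds are estimates of \<open>D\<close> from
  \<open>a (Suc (Suc n)) \<le> c \<le> a (Suc (Suc n)) + 1\<close> and the monotonicity of the
  denominators.\<close>

lemma cf_convergent_dist:
  assumes "\<theta> \<notin> \<rat>"
  defines "a \<equiv> \<lambda>n. real_of_int (cf_digit \<theta> n)" and "q \<equiv> \<lambda>n. real_of_int (cf_denom \<theta> n)"
    and "p \<equiv> \<lambda>n. real_of_int (cf_numer \<theta> n)"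
  shows "\<bar>\<theta> - p (Suc n) / q (Suc n)\<bar> \<le> 1 / (a (Suc (Suc n)) * (q (Suc n))\<^sup>2)"
    and "\<bar>\<theta> - p (Suc n) / q (Suc n)\<bar> \<le> 1 / (q (Suc n) * q (Suc (Suc n)))"
    and "1 / ((a (Suc (Suc n)) + 2) * (q (Suc n))\<^sup>2) \<le> \<bar>\<theta> - p (Suc n) / q (Suc n)\<bar>"
proof -
  define c where "c = cf_quot \<theta> (Suc (Suc n))"
  have q: "1 \<le> q n" "1 \<le> q (Suc n)" "q n \<le> q (Suc n)"
    using cf_denom_ge[OF assms(1), of n] cf_denom_ge[OF assms(1), of "Suc n"] cf_denom_mono[OF assms(1), of n]
    unfolding q_def by (auto simp del: cf_denom.simps)
  have a: "1 \<le> a (Suc (Suc n))" "a (Suc (Suc n)) \<le> c" "c \<le> a (Suc (Suc n)) + 1"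
    using cf_digit_ge_1[OF assms(1), of "Suc n"] unfolding a_def c_def cf_digit_def
    by (auto simp del: cf_quot.simps)
  have q2: "q (Suc (Suc n)) = a (Suc (Suc n)) * q (Suc n) + q n" unfolding q_def a_def by simp
  have id: "\<theta> * (c * q (Suc n) + q n) = c * p (Suc n) + p n"
    using cf_quot_identity[OF assms(1), of n] unfolding c_def p_def q_def by simp
  have "real_of_int \<bar>cf_numer \<theta> (Suc n) * cf_denom \<theta> n - cf_numer \<theta> n * cf_denom \<theta> (Suc n)\<bar> = 1"
    by (simp only: cf_determinant of_int_1)
  then have det: "\<bar>p (Suc n) * q n - p n * q (Suc n)\<bar> = 1" unfolding p_def q_def by simp
  define D where "D = c * q (Suc n) + q n"
  have D: "a (Suc (Suc n)) * q (Suc n) \<le> D" "q (Suc (Suc n)) \<le> D" "D \<le> (a (Suc (Suc n)) + 2) * q (Suc n)"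
  proof -
    have "a (Suc (Suc n)) * q (Suc n) \<le> c * q (Suc n)" "c * q (Suc n) \<le> (a (Suc (Suc n)) + 1) * q (Suc n)"
      using a q by (auto intro!: mult_right_mono)
    moreover have "(a (Suc (Suc n)) + 2) * q (Suc n) = (a (Suc (Suc n)) + 1) * q (Suc n) + q (Suc n)"
      by (simp add: algebra_simps)
    ultimately show "a (Suc (Suc n)) * q (Suc n) \<le> D" "q (Suc (Suc n)) \<le> D" "D \<le> (a (Suc (Suc n)) + 2) * q (Suc n)"
      using q unfolding D_def q2 by linarith+
  qed
  have aq: "0 < a (Suc (Suc n)) * q (Suc n)" using a q by simp
  have D0: "0 < D" using D aq by linarith
  have "(p (Suc n) - \<theta> * q (Suc n)) * D = p (Suc n) * q n - p n * q (Suc n)"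
    using id unfolding D_def by algebra
  then have "\<bar>p (Suc n) - \<theta> * q (Suc n)\<bar> * D = 1" using det D0 by (metis abs_mult abs_of_pos)
  then have "\<bar>p (Suc n) - \<theta> * q (Suc n)\<bar> = 1 / D" using D0 by (simp add: field_simps)
  moreover have "\<theta> - p (Suc n) / q (Suc n) = - ((p (Suc n) - \<theta> * q (Suc n)) / q (Suc n))" using q by (simp add: field_simps)
  ultimately have dist: "\<bar>\<theta> - p (Suc n) / q (Suc n)\<bar> = 1 / (q (Suc n) * D)"
    using q by (simp only: abs_minus_cancel abs_divide) simp
  show "\<bar>\<theta> - p (Suc n) / q (Suc n)\<bar> \<le> 1 / (a (Suc (Suc n)) * (q (Suc n))\<^sup>2)"
  proof -
    have "q (Suc n) * (a (Suc (Suc n)) * q (Suc n)) \<le> q (Suc n) * D" using D q by (intro mult_left_mono) auto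
    then show ?thesis unfolding dist using aq q D0
      by (intro divide_left_mono) (auto simp: power2_eq_square algebra_simps zero_less_mult_iff)
  qed
  show "\<bar>\<theta> - p (Suc n) / q (Suc n)\<bar> \<le> 1 / (q (Suc n) * q (Suc (Suc n)))"
    unfolding dist using D q D0 aq by (intro divide_left_mono mult_left_mono mult_pos_pos) (auto simp: q2)
  show "1 / ((a (Suc (Suc n)) + 2) * (q (Suc n))\<^sup>2) \<le> \<bar>\<theta> - p (Suc n) / q (Suc n)\<bar>"
  proof -
    have "q (Suc n) * D \<le> q (Suc n) * ((a (Suc (Suc n)) + 2) * q (Suc n))" using D q by (intro mult_left_mono) auto
    then show ?thesis unfolding dist using a q D0
      by (intro divide_left_mono) (auto simp: power2_eq_square algebra_simps zero_less_mult_iff add_pos_pos)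
  qed
qed

section \<open>The exponent A in terms of rates of approximation\<close>

lemma A_exp_shift:
  "A_exp \<alpha> \<theta> = limsup (\<lambda>n. ereal (real_of_int (cf_digit \<theta> (Suc (Suc n))) * real_of_int (cf_denom \<theta> (Suc n)) powr (1 - \<alpha>)))"
  unfolding A_exp_def
  using limsup_shift[of "\<lambda>n. ereal (real_of_int (cf_digit \<theta> (Suc n)) * real_of_int (cf_denom \<theta> n) powr (1 - \<alpha>))"]
  by simp

text \<open>Infinitely often a partial quotient exceeds
  \<open>\<delta> * q powr (\<alpha> - 1)\<close> for the preceding denominator \<open>q\<close>,
  and the convergent with that denominator then has the required quality with
  \<open>C = 1 / \<delta>\<close>.\<close>

lemma Theta_lower_approximable:
  assumes "\<theta> \<in> Theta_lower \<alpha>"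
  shows "\<exists>C>0. \<forall>N. \<exists>q\<ge>N. \<exists>p. \<bar>\<theta> - real_of_int p / real q\<bar> \<le> C * real q powr - (\<alpha> + 1)"
proof -
  have irr: "\<theta> \<notin> \<rat>" and A: "A_exp \<alpha> \<theta> > 0" using assms unfolding Theta_lower_def by auto
  obtain \<delta> where \<delta>: "0 < \<delta>" "ereal \<delta> < A_exp \<alpha> \<theta>" using ereal_dense2[OF A] by auto
  define x where "x n = real_of_int (cf_digit \<theta> (Suc (Suc n))) * real_of_int (cf_denom \<theta> (Suc n)) powr (1 - \<alpha>)" for n
  have fr: "\<exists>n\<ge>N. \<delta> < x n" for N
  proof (rule ccontr)
    assume "\<not> (\<exists>n\<ge>N. \<delta> < x n)"
    then have "eventually (\<lambda>n. ereal (x n) \<le> ereal \<delta>) sequentially"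
      unfolding eventually_sequentially by (auto simp: not_less)
    then have "A_exp \<alpha> \<theta> \<le> ereal \<delta>" unfolding A_exp_shift x_def by (rule Limsup_bounded)
    then show False using \<delta> by simp
  qed
  have "\<exists>q\<ge>N. \<exists>p. \<bar>\<theta> - real_of_int p / real q\<bar> \<le> 1 / \<delta> * real q powr - (\<alpha> + 1)" for N
  proof -
    obtain n where n: "N \<le> n" "\<delta> < x n" using fr by blast
    define q where "q = nat (cf_denom \<theta> (Suc n))"
    have "int (Suc n) \<le> cf_denom \<theta> (Suc n)" using cf_denom_ge[OF irr, of n] by simp
    then have q: "real_of_int (cf_denom \<theta> (Suc n)) = real q" "N \<le> q" "1 \<le> q"
      using n unfolding q_def by auto
    define a where "a = real_of_int (cf_digit \<theta> (Suc (Suc n)))"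
    have a: "1 \<le> a" using cf_digit_ge_1[OF irr, of "Suc n"] unfolding a_def by simp
    have "\<delta> < a * real q powr (1 - \<alpha>)" using n(2) unfolding x_def q(1) a_def .
    then have "\<delta> * real q powr (\<alpha> + 1) \<le> a * real q powr (1 - \<alpha>) * real q powr (\<alpha> + 1)"
      by (intro mult_right_mono) auto
    also have "\<dots> = a * (real q)\<^sup>2" using q by (simp add: powr_add[symmetric] powr_numeral mult.assoc)
    finally have le: "\<delta> * real q powr (\<alpha> + 1) \<le> a * (real q)\<^sup>2" .
    have "\<bar>\<theta> - real_of_int (cf_numer \<theta> (Suc n)) / real q\<bar> \<le> 1 / (a * (real q)\<^sup>2)"
      using cf_convergent_dist(1)[OF irr, of n] unfolding q(1) a_def .
    also have "\<dots> \<le> 1 / (\<delta> * real q powr (\<alpha> + 1))"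
      using le \<delta> q a by (intro divide_left_mono mult_pos_pos) auto
    also have "\<dots> = 1 / \<delta> * real q powr - (\<alpha> + 1)" by (simp only: powr_minus) (simp add: divide_inverse)
    finally show ?thesis using q by blast
  qed
  then show ?thesis using \<delta>(1) by (intro exI[of _ "1 / \<delta>"]) auto
qed

text \<open>If \<open>q\<^sub>n\<^sub>+\<^sub>1 < 2Q \<le> q\<^sub>n\<^sub>+\<^sub>2\<close>, then \<open>|\<theta> - p\<^sub>n\<^sub>+\<^sub>1/q\<^sub>n\<^sub>+\<^sub>1| \<le> 1/(2Qq\<^sub>n\<^sub>+\<^sub>1)\<close> is at most half the least
  possible distance between \<open>P/Q\<close> and a different fraction with denominator \<open>q\<^sub>n\<^sub>+\<^sub>1\<close>.\<close>

lemma good_approximation_is_convergent: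
  assumes irr: "\<theta> \<notin> \<rat>" and Q: "1 \<le> Q" and near: "\<bar>\<theta> - real_of_int P / real Q\<bar> < 1 / (4 * (real Q)\<^sup>2)"
    and n: "cf_denom \<theta> (Suc n) < 2 * int Q" "2 * int Q \<le> cf_denom \<theta> (Suc (Suc n))"
  shows "real_of_int P / real Q = real_of_int (cf_numer \<theta> (Suc n)) / real_of_int (cf_denom \<theta> (Suc n))"
proof (rule ccontr)
  assume ne: "\<not> ?thesis"
  define q where "q = nat (cf_denom \<theta> (Suc n))"
  have "int (Suc n) \<le> cf_denom \<theta> (Suc n)" using cf_denom_ge[OF irr, of n] by simp
  then have q: "real_of_int (cf_denom \<theta> (Suc n)) = real q" "1 \<le> q" "real q < 2 * real Q"
    using n unfolding q_def by linarith+
  define z where "z = 1 / (real Q * real q)"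
  have "z \<le> \<bar>real_of_int P / real Q - real_of_int (cf_numer \<theta> (Suc n)) / real q\<bar>"
    unfolding z_def using distinct_fractions_dist[of Q q P "cf_numer \<theta> (Suc n)"] ne Q q by simp
  moreover have "\<bar>\<theta> - real_of_int (cf_numer \<theta> (Suc n)) / real q\<bar> \<le> z / 2"
  proof -
    have "\<bar>\<theta> - real_of_int (cf_numer \<theta> (Suc n)) / real q\<bar> \<le> 1 / (real q * real_of_int (cf_denom \<theta> (Suc (Suc n))))"
      using cf_convergent_dist(2)[OF irr, of n] unfolding q(1) .
    also have "\<dots> \<le> 1 / (real q * (2 * real Q))"
      using q Q n by (intro divide_left_mono mult_left_mono mult_pos_pos) linarith+
    finally show ?thesis unfolding z_def by (simp add: mult_ac)
  qed
  moreover have "1 / (4 * (real Q)\<^sup>2) \<le> z / 2"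
  proof -
    have "2 * (real Q * real q) \<le> 2 * (real Q * (2 * real Q))" using q by (intro mult_left_mono) auto
    then have "1 / (4 * (real Q)\<^sup>2) \<le> 1 / (2 * (real Q * real q))"
      using q Q by (intro divide_left_mono) (auto simp: power2_eq_square)
    then show ?thesis unfolding z_def by simp
  qed
  ultimately show False using near by linarith
qed

lemma exactly_approximable_irrational:
  assumes "\<theta> \<in> exactly_approximable \<tau>"
  shows "\<theta> \<notin> \<rat>"
proof
  assume "\<theta> \<in> \<rat>"
  then obtain p q where "\<theta> = real_of_int p / real q" "q \<noteq> 0" by (auto simp: Rats_eq_int_div_nat)
  moreover obtain c where "c > 0" "\<And>q p. 1 \<le> q \<Longrightarrow> c * real q powr - \<tau> \<le> \<bar>\<theta> - real_of_int p / real q\<bar>"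
    using assms unfolding exactly_approximable_def by blast
  ultimately have "c * real q powr - \<tau> \<le> 0" by (metis One_nat_def Suc_leI abs_zero diff_self neq0_conv)
  moreover have "0 < c * real q powr - \<tau>" using \<open>c > 0\<close> \<open>q \<noteq> 0\<close> by simp
  ultimately show False by linarith
qed

text \<open>Finiteness of \<open>A_exp\<close> follows by testing the lower bound on distances at
  the convergents. For positivity, good fractions of large denominator are values of convergents,
  and their quality forces a large next partial quotient.\<close>

lemma exactly_approximable_subset_Theta:
  assumes \<alpha>: "\<alpha> > 1"
  shows "{0..1} \<inter> exactly_approximable (\<alpha> + 1) \<subseteq> Theta \<alpha>"
proof
  fix \<theta> assume \<theta>: "\<theta> \<in> {0..1} \<inter> exactly_approximable (\<alpha> + 1)"
  then have irr: "\<theta> \<notin> \<rat>" using exactly_approximable_irrational by blast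
  obtain c where c: "c > 0" and far: "\<And>q p. 1 \<le> q \<Longrightarrow> c * real q powr - (\<alpha> + 1) \<le> \<bar>\<theta> - real_of_int p / real q\<bar>"
    using \<theta> unfolding exactly_approximable_def by blast
  have near: "\<exists>q\<ge>N. \<exists>p. \<bar>\<theta> - real_of_int p / real q\<bar> \<le> 2 * real q powr - (\<alpha> + 1)" for N
    using \<theta> unfolding exactly_approximable_def by blast
  define x where "x n = real_of_int (cf_digit \<theta> (Suc (Suc n))) * real_of_int (cf_denom \<theta> (Suc n)) powr (1 - \<alpha>)" for n
  define a where "a n = real_of_int (cf_digit \<theta> (Suc (Suc n)))" for n
  define q where "q n = nat (cf_denom \<theta> (Suc n))" for n
  have q: "int (q n) = cf_denom \<theta> (Suc n)" "real_of_int (cf_denom \<theta> (Suc n)) = real (q n)" "Suc n \<le> q n" for n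
    using cf_denom_ge[OF irr, of n] unfolding q_def by auto
  have a1: "1 \<le> a n" for n using cf_digit_ge_1[OF irr, of "Suc n"] unfolding a_def by simp
  have x: "x n = a n * real (q n) powr (1 - \<alpha>)" for n unfolding x_def a_def q(2) ..
  have split: "real (q n) powr (1 - \<alpha>) = (real (q n))\<^sup>2 * real (q n) powr - (\<alpha> + 1)" for n
    using q(3)[of n] powr_add[of "real (q n)" 2 "- (\<alpha> + 1)"] by (simp add: powr_numeral)
  have upper: "x n \<le> 1 / c" for n
  proof -
    have "c * real (q n) powr - (\<alpha> + 1) \<le> 1 / (a n * (real (q n))\<^sup>2)"
      using cf_convergent_dist(1)[OF irr, of n] far[of "q n" "cf_numer \<theta> (Suc n)"] q(3)[of n]
      unfolding q(2) a_def by linarith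
    then have "c * (a n * ((real (q n))\<^sup>2 * real (q n) powr - (\<alpha> + 1))) \<le> 1"
      using a1[of n] q(3)[of n] by (simp add: field_simps)
    then show ?thesis unfolding x split using c by (simp add: field_simps)
  qed
  have "A_exp \<alpha> \<theta> \<le> ereal (1 / c)" unfolding A_exp_shift x_def[symmetric]
    using upper by (intro Limsup_bounded) auto
  then have "A_exp \<alpha> \<theta> < \<infinity>" by (rule le_less_trans) simp
  \<comment> \<open>6 = 2 * 3: the constant 2 of the approximation and
    \<open>a n + 2 \<le> 3 * a n\<close>. The power of 2 is the loss from using
    \<open>q n < 2 * Q\<close>.\<close>
  define \<delta> where "\<delta> = 1 / (6 * 2 powr (\<alpha> + 1))"
  have \<delta>: "0 < \<delta>" unfolding \<delta>_def by simp
  have q_mono: "mono q" unfolding q_def mono_iff_le_Suc using cf_denom_mono[OF irr] by (intro allI nat_mono) blast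
  have lower: "\<exists>n\<ge>N. \<delta> \<le> x n" for N
  proof -
    \<comment> \<open>9 exceeds 2 * 4, so the approximation beats \<open>1 / (4 * Q^2)\<close>;
      \<open>q N < Q\<close> pushes the index of the convergent to at least
      \<open>N\<close>.\<close>
    have "eventually (\<lambda>Q. Suc (q N) \<le> Q \<and> 9 \<le> real Q powr (\<alpha> - 1)) sequentially"
      using \<alpha> by (intro eventually_conj eventually_powr_ge eventually_ge_at_top) auto
    then obtain Q0 where Q0: "\<And>Q. Q0 \<le> Q \<Longrightarrow> Suc (q N) \<le> Q \<and> 9 \<le> real Q powr (\<alpha> - 1)"
      unfolding eventually_sequentially by blast
    obtain Q P where Q: "Suc (q N) \<le> Q" "9 \<le> real Q powr (\<alpha> - 1)"
      and PQ: "\<bar>\<theta> - real_of_int P / real Q\<bar> \<le> 2 * real Q powr - (\<alpha> + 1)"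
      using near[of Q0] Q0 by blast
    define n where "n = (LEAST n. 2 * Q \<le> q (Suc n))"
    have "2 * Q \<le> q (Suc (2 * Q))" using q(3)[of "Suc (2 * Q)"] by simp
    then have n1: "2 * Q \<le> q (Suc n)" unfolding n_def by (rule LeastI)
    have "q N < q (Suc n)" using n1 Q by linarith
    then have "N < Suc n" using q_mono by (meson leD leI monoD)
    \<comment> \<open>Minimality of \<open>n\<close> gives this for positive \<open>n\<close>; for
      \<open>n = 0\<close> it comes from \<open>q 0 \<le> q N < Q\<close>.\<close>
    have n2: "q n < 2 * Q"
    proof (cases n)
      case 0
      then show ?thesis using q_mono[THEN monoD, of 0 N] Q by simp
    next
      case (Suc m)
      then show ?thesis using not_less_Least[of m "\<lambda>n. 2 * Q \<le> q (Suc n)"] n_def by simp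
    qed
    have "2 * real Q powr - (\<alpha> + 1) < 1 / (4 * (real Q)\<^sup>2)"
    proof -
      have "real Q powr - (\<alpha> + 1) * (real Q)\<^sup>2 * real Q powr (\<alpha> - 1) = 1"
        using Q(1) powr_add[of "real Q" "- (\<alpha> + 1)" 2] powr_add[of "real Q" "1 - \<alpha>" "\<alpha> - 1"]
        by (simp add: powr_numeral)
      moreover have "real Q powr - (\<alpha> + 1) * (real Q)\<^sup>2 * 9 \<le> real Q powr - (\<alpha> + 1) * (real Q)\<^sup>2 * real Q powr (\<alpha> - 1)"
        using Q(2) by (intro mult_left_mono) auto
      ultimately show ?thesis using Q(1) by (simp add: field_simps)
    qed
    then have conv: "real_of_int P / real Q = real_of_int (cf_numer \<theta> (Suc n)) / real (q n)"
      using good_approximation_is_convergent[OF irr, of Q P n] PQ Q(1) n1 n2 q(1)[of n] q(1)[of "Suc n"]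
      unfolding q(2) by linarith
    have "1 / ((a n + 2) * (real (q n))\<^sup>2) \<le> 2 * real Q powr - (\<alpha> + 1)"
      using cf_convergent_dist(3)[OF irr, of n] PQ conv unfolding q(2) a_def by linarith
    also have "\<dots> \<le> 2 * (real (q n) / 2) powr - (\<alpha> + 1)"
      using n2 q(3)[of n] \<alpha> by (intro mult_left_mono powr_mono2') auto
    also have "(real (q n) / 2) powr - (\<alpha> + 1) = real (q n) powr - (\<alpha> + 1) / 2 powr - (\<alpha> + 1)" by (rule powr_divide)
    also have "\<dots> = 2 powr (\<alpha> + 1) * real (q n) powr - (\<alpha> + 1)" by (simp only: powr_minus divide_inverse inverse_inverse_eq mult.commute)
    finally have "1 \<le> 2 * (2 powr (\<alpha> + 1) * real (q n) powr - (\<alpha> + 1)) * ((a n + 2) * (real (q n))\<^sup>2)"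
      using a1[of n] q(3)[of n] by (subst (asm) pos_divide_le_eq) auto
    also have "\<dots> = 2 * 2 powr (\<alpha> + 1) * (a n + 2) * real (q n) powr (1 - \<alpha>)" unfolding split by (simp add: mult_ac)
    also have "\<dots> \<le> 2 * 2 powr (\<alpha> + 1) * (3 * a n) * real (q n) powr (1 - \<alpha>)"
      using a1[of n] by (intro mult_right_mono mult_left_mono) auto
    also have "\<dots> = 6 * 2 powr (\<alpha> + 1) * x n" unfolding x by simp
    finally have "\<delta> \<le> x n" unfolding \<delta>_def by (simp add: field_simps)
    then show ?thesis using \<open>N < Suc n\<close> by (intro exI[of _ n]) simp
  qed
  have "0 < A_exp \<alpha> \<theta>"
  proof (rule ccontr)
    assume "\<not> 0 < A_exp \<alpha> \<theta>"
    then have "A_exp \<alpha> \<theta> < ereal \<delta>" using \<delta> by (meson ereal_less(2) le_less_trans not_less)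
    then have "eventually (\<lambda>n. ereal (x n) < ereal \<delta>) sequentially"
      unfolding A_exp_shift x_def[symmetric] by (rule Limsup_lessD)
    then show False using lower unfolding eventually_sequentially by (meson leD less_ereal.simps(1))
  qed
  then show "\<theta> \<in> Theta \<alpha>"
    using \<theta> irr \<open>A_exp \<alpha> \<theta> < \<infinity>\<close> unfolding Theta_def Theta_lower_def Theta_upper_def by auto
qed

section \<open>Dimension and measure of the sets\<close>

lemma Theta_lower_null:
  assumes \<alpha>: "\<alpha> > 1" and s: "2 / (\<alpha> + 1) < s" "s \<le> 1"
  shows "hausdorff_measure s (Theta_lower \<alpha>) = 0"
proof -
  define \<tau> where "\<tau> = \<alpha> + 1"
  have s0: "0 < s" using s \<alpha> less_trans[of 0 "2 / (\<alpha> + 1)" s] by simp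
  \<comment> \<open>Lowering the exponent from \<tau> to \<open>t\<close> absorbs the constant
    \<open>C\<close>, which depends on the point, while \<open>2 / s < t\<close> keeps the covering
    series convergent.\<close>
  define t where "t = (2 / s + \<tau>) / 2"
  have "2 / s < \<tau>" using s s0 \<alpha> unfolding \<tau>_def by (simp add: field_simps)
  then have t: "2 / s < t" "t < \<tau>" unfolding t_def by auto
  have "2 \<le> 2 / s" using s s0 by (simp add: field_simps)
  then have t2: "2 < t" using t by linarith
  show ?thesis
  proof (rule hausdorff_measure_limsup_null[OF s0, of t])
    show "2 < t * s" using t(1) s0 by (simp add: field_simps)
    fix x N assume x: "x \<in> Theta_lower \<alpha>"
    then have x01: "0 \<le> x" "x \<le> 1" unfolding Theta_lower_def by auto
    obtain C where "C > 0" and C: "\<And>N. \<exists>q\<ge>N. \<exists>p. \<bar>x - real_of_int p / real q\<bar> \<le> C * real q powr - \<tau>"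
      using Theta_lower_approximable[OF x] unfolding \<tau>_def by blast
    obtain N' where N': "\<And>q. N' \<le> q \<Longrightarrow> C \<le> real q powr (\<tau> - t)"
      using eventually_powr_ge[of "\<tau> - t" C] t unfolding eventually_sequentially by auto
    obtain q p where q: "max 2 (max N N') \<le> q" and p: "\<bar>x - real_of_int p / real q\<bar> \<le> C * real q powr - \<tau>"
      using C by blast
    have "C * real q powr - \<tau> \<le> real q powr (\<tau> - t) * real q powr - \<tau>" using N'[of q] q by (intro mult_right_mono) auto
    also have "\<dots> = real q powr - t" by (simp add: powr_add[symmetric])
    finally have near: "\<bar>x - real_of_int p / real q\<bar> \<le> real q powr - t" using p by linarith
    \<comment> \<open>As \<open>t > 2\<close>, the error is below \<open>1 / q\<close>; for
      \<open>x\<close> in the unit interval this confines the integer \<open>p\<close> to the range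
      from 0 to \<open>q\<close> used by the covers.\<close>
    have "real q powr - t < real q powr - 1" using q t2 by (intro powr_less_mono) auto
    also have "\<dots> = 1 / real q" using q by (simp add: powr_minus divide_inverse)
    finally have less: "\<bar>x - real_of_int p / real q\<bar> < 1 / real q" using near by linarith
    have q0: "0 < real q" using q by auto
    have "\<bar>x * real q - real_of_int p\<bar> = \<bar>x - real_of_int p / real q\<bar> * real q"
      using q0 by (simp add: abs_mult[symmetric, of _ "real q", simplified] left_diff_distrib)
    also have "\<dots> < 1" using less q0 by (simp add: field_simps)
    finally have "\<bar>x * real q - real_of_int p\<bar> < 1" .
    moreover have "0 \<le> x * real q" "x * real q \<le> real q" using x01 q0 by (auto simp: mult_left_le_one_le)
    ultimately have "- 1 < real_of_int p" "real_of_int p < real q + 1" by linarith+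
    then have "0 \<le> p" "p \<le> int q" by linarith+
    then have "real (nat p) = real_of_int p" "nat p \<le> q" by auto
    then show "\<exists>q\<ge>N. \<exists>p\<le>q. \<bar>x - real p / real q\<bar> \<le> real q powr - t"
      using near q by (intro exI[of _ q] conjI exI[of _ "nat p"]) auto
  qed
qed

theorem theorem3p7:
  fixes \<alpha> :: real
  assumes "\<alpha> > 1"
  shows "hausdorff_dim (Theta \<alpha>) = ennreal (2 / (\<alpha> + 1))
       \<and> hausdorff_dim (Theta_lower \<alpha>) = ennreal (2 / (\<alpha> + 1))
       \<and> emeasure lebesgue (Theta_upper \<alpha>) = 1"
proof -
  define d where "d = 2 / (\<alpha> + 1)"
  have d: "0 < d" "d < 1" using assms unfolding d_def by auto
  \<comment> \<open>By monotonicity one argument serves both sets: the upper bound is inherited from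
    \<open>Theta_lower\<close>, the lower bound from \<open>Theta\<close>.\<close>
  have dim: "hausdorff_dim S = ennreal d" if S: "Theta \<alpha> \<subseteq> S" "S \<subseteq> Theta_lower \<alpha>" for S
  proof (rule antisym)
    show "hausdorff_dim S \<le> ennreal d"
    proof (rule ennreal_le_epsilon)
      fix e :: real assume "0 < e"
      define s where "s = min 1 (d + e)"
      have s: "d < s" "s \<le> 1" "s \<le> d + e" using d \<open>0 < e\<close> unfolding s_def by auto
      have "hausdorff_measure s S \<le> 0"
        using Theta_lower_null[OF assms, of s] hausdorff_measure_mono[OF S(2), of s] s unfolding d_def by simp
      then have "hausdorff_dim S \<le> ennreal s"
        unfolding hausdorff_dim_def using d s by (intro Inf_lower) auto
      also have "\<dots> \<le> ennreal d + ennreal e"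
        using s d \<open>0 < e\<close> by (simp add: ennreal_leI flip: ennreal_plus)
      finally show "hausdorff_dim S \<le> ennreal d + ennreal e" .
    qed
    have sub: "{0..1} \<inter> exactly_approximable (\<alpha> + 1) \<subseteq> S"
      using exactly_approximable_subset_Theta[OF assms] S(1) by blast
    show "ennreal d \<le> hausdorff_dim S"
      unfolding hausdorff_dim_def d_def using hausdorff_null_exponent_ge[OF _ sub] assms
      by (auto intro!: Inf_greatest ennreal_leI)
  qed
  \<comment> \<open>An irrational point of the unit interval outside \<open>Theta_upper\<close> has
    infinite \<open>A_exp\<close>, hence lies in \<open>Theta_lower\<close>, which is null already
    for exponent 1 because \<open>d < 1\<close>.\<close>
  have null: "{0..1} - Theta_upper \<alpha> \<in> null_sets lebesgue"
  proof -
    have "negligible (Theta_lower \<alpha>)"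
      using Theta_lower_null[OF assms, of 1] d unfolding d_def
      by (intro hausdorff_measure_null_negligible) simp
    moreover have "negligible (\<rat> :: real set)"
      by (simp add: negligible_iff_null_sets null_sets_completionI countable_imp_null_set_lborel countable_rat)
    moreover have "{0..1} - Theta_upper \<alpha> \<subseteq> Theta_lower \<alpha> \<union> \<rat>"
      unfolding Theta_upper_def Theta_lower_def by auto
    ultimately have "negligible ({0..1} - Theta_upper \<alpha>)"
      by (meson negligible_Un negligible_subset)
    then show ?thesis by (simp add: negligible_iff_null_sets)
  qed
  have "Theta_upper \<alpha> = {0..1} - ({0..1} - Theta_upper \<alpha>)" unfolding Theta_upper_def by auto
  then have "emeasure lebesgue (Theta_upper \<alpha>) = emeasure lebesgue {0..1::real}"
    using emeasure_Diff_null_set[OF null, of "{0..1}"] by simp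
  then have "emeasure lebesgue (Theta_upper \<alpha>) = 1" by simp
  moreover have "hausdorff_dim (Theta \<alpha>) = ennreal d" "hausdorff_dim (Theta_lower \<alpha>) = ennreal d"
    by (rule dim; auto simp: Theta_def)+
  ultimately show ?thesis unfolding d_def by simp
qed

end
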